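(* Let $\varepsilon:\{0,1\}^{\mathbb N}\to\mathcal L(\{0,1\})^{\mathcal L(\mathbb N)}$ send $\alpha$ to $\mathcal L(\alpha)$. Every element in the image of $\varepsilon$ is sharp, but not every element in the image of $\varepsilon$ is maximal. Also, not every sharp element of $\mathcal L(\{0,1\})^{\mathcal L(\mathbb N)}$ is in the image of $\varepsilon$.
   Context: We work constructively: informal set theory without excluded middle or choice. For a set $X$, the lifting $\mathcal L(X)$ (the free pointed dcpo on $X$) can be taken to be the set of subsingleton subsets of $X$ (subsets $S$ with $a=b$ for all $a,b\in S$), ordered by inclusion with directed suprema given by unions and least element $\emptyset$; the unit is $\eta(x)=\{x\}$, and a map $f:X\to Y$ induces the Scott continuous strict map $\mathcal L(f)(S)=f[S]$. For dcpos $D,E$, $E^D$ is the dcpo of Scott continuous (directed-supremum-preserving) maps $D\to E$ ordered pointwise, with pointwise directed suprema. In a dcpo, $x\ll y$ if for every directed $S$ with $y\sqsubseteq\bigsqcup S$ some $s\in S$ has $x\sqsubseteq s$. An element $x$ is sharp if for all $u\ll v$, $u\ll x$ or $\neg(v\sqsubseteq x)$; it is maximal if $x\sqsubseteq y$ implies $y\sqsubseteq x$. *)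

theory Defs
  imports Main
begin

text \<open>
  The theorem belongs to constructive mathematics. Read in the classical meta-logic of HOL it would
  lose its content (with excluded middle every element of every dcpo is sharp). The notions below
  are therefore the usual set-theoretic definitions read in the Heyting-valued
  semantics of intuitionistic higher-order logic: a proposition is an element of an
  arbitrary complete Heyting algebra \<open>'h\<close>, the connectives and quantifiers are the
  Heyting operations, and a proposition holds if its value is \<open>top\<close>. Excluded middle
  and choice are not valid in this semantics in general. For \<open>'h = bool\<close> one gets back the usual
  connectives (lemma \<open>connectives_bool\<close>).
\<close>

section \<open>Heyting-valued logic\<close>

class complete_heyting_algebra = complete_lattice +
  assumes inf_Sup_distrib: "inf a (Sup B) = Sup (inf a ` B)"

definition hand :: "'h::complete_heyting_algebra \<Rightarrow> 'h \<Rightarrow> 'h"  (infixr "\<^bold>\<and>" 35)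
  where "(p \<^bold>\<and> q) = inf p q"

definition hor :: "'h::complete_heyting_algebra \<Rightarrow> 'h \<Rightarrow> 'h"  (infixr "\<^bold>\<or>" 30)
  where "(p \<^bold>\<or> q) = sup p q"

definition himp :: "'h::complete_heyting_algebra \<Rightarrow> 'h \<Rightarrow> 'h"  (infixr "\<^bold>\<longrightarrow>" 25)
  where "(p \<^bold>\<longrightarrow> q) = Sup {r. inf r p \<le> q}"

definition hiff :: "'h::complete_heyting_algebra \<Rightarrow> 'h \<Rightarrow> 'h"  (infix "\<^bold>\<longleftrightarrow>" 25)
  where "(p \<^bold>\<longleftrightarrow> q) = ((p \<^bold>\<longrightarrow> q) \<^bold>\<and> (q \<^bold>\<longrightarrow> p))"

definition hnot :: "'h::complete_heyting_algebra \<Rightarrow> 'h"  ("\<^bold>\<not> _" [40] 40)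
  where "(\<^bold>\<not> p) = (p \<^bold>\<longrightarrow> bot)"

definition hall :: "('a \<Rightarrow> 'h::complete_heyting_algebra) \<Rightarrow> 'h"  (binder "\<^bold>\<forall>" 10)
  where "(\<^bold>\<forall>x. P x) = (INF x. P x)"

definition hex :: "('a \<Rightarrow> 'h::complete_heyting_algebra) \<Rightarrow> 'h"  (binder "\<^bold>\<exists>" 10)
  where "(\<^bold>\<exists>x. P x) = (SUP x. P x)"

definition valid :: "'h::complete_heyting_algebra \<Rightarrow> bool"
  where "valid p \<longleftrightarrow> p = top"

lemma himp_adjoint: "r \<le> (p \<^bold>\<longrightarrow> q) \<longleftrightarrow> inf r p \<le> q"
proof
  have "inf p (Sup {r. inf r p \<le> q}) \<le> q"
    unfolding inf_Sup_distrib by (rule Sup_least) (auto simp: inf_commute)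
  moreover assume "r \<le> (p \<^bold>\<longrightarrow> q)"
  ultimately show "inf r p \<le> q"
    unfolding himp_def by (metis inf_commute inf_mono order_refl order_trans)
next
  assume "inf r p \<le> q"
  then show "r \<le> (p \<^bold>\<longrightarrow> q)"
    unfolding himp_def by (simp add: Sup_upper)
qed

instance bool :: complete_heyting_algebra
  by standard auto

lemma connectives_bool:
  "(p \<^bold>\<and> q) = (p \<and> q)" "(p \<^bold>\<or> q) = (p \<or> q)" "(p \<^bold>\<longrightarrow> q) = (p \<longrightarrow> q)"
  "(p \<^bold>\<longleftrightarrow> q) = (p \<longleftrightarrow> q)" "(\<^bold>\<not> p) = (\<not> p)"
  "(\<^bold>\<forall>x. P x) = (\<forall>x. P x)" "(\<^bold>\<exists>x. P x) = (\<exists>x. P x)" "valid p = p"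
  by (auto simp: hand_def hor_def himp_def hiff_def hnot_def hall_def hex_def valid_def)


section \<open>Sets, subsets and functions\<close>

text \<open>
  A set is given by an underlying type together with the truth values of ``\<open>x\<close> is an element'' and
  of ``\<open>x\<close> and \<open>y\<close> are equal'' (the latter is meaningful only between elements).
  Subsets are extensional predicates, functions are functional relations.
\<close>

record ('a, 'h) hset =
  elem :: "'a \<Rightarrow> 'h"
  eql :: "'a \<Rightarrow> 'a \<Rightarrow> 'h"

record ('a, 'h) hposet = "('a, 'h) hset" +
  leq :: "'a \<Rightarrow> 'a \<Rightarrow> 'h"

text \<open>
  The interpretation of the set of natural numbers is \<open>discrete :: (nat, 'h) hset\<close>, and that of
  the two-element set \<open>{0, 1}\<close> is \<open>discrete :: (bool, 'h) hset\<close>, where \<open>False\<close> is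
  \<open>0\<close> and \<open>True\<close> is \<open>1\<close>.
\<close>

definition discrete :: "('a, 'h::complete_heyting_algebra) hset"
  where "discrete = \<lparr>elem = (\<lambda>x. top), eql = (\<lambda>x y. if x = y then top else bot)\<rparr>"

definition is_subset ::
    "('a, 'h::complete_heyting_algebra, 'z) hset_scheme \<Rightarrow> ('a \<Rightarrow> 'h) \<Rightarrow> 'h"
  where "is_subset X S =
    ((\<^bold>\<forall>x. S x \<^bold>\<longrightarrow> elem X x) \<^bold>\<and>
     (\<^bold>\<forall>x y. S x \<^bold>\<and> elem X y \<^bold>\<and> eql X x y \<^bold>\<longrightarrow> S y))"

definition is_function ::
    "('a, 'h::complete_heyting_algebra, 'y) hset_scheme \<Rightarrow> ('b, 'h, 'z) hset_scheme
      \<Rightarrow> ('a \<Rightarrow> 'b \<Rightarrow> 'h) \<Rightarrow> 'h"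
  where "is_function X Y f =
    ((\<^bold>\<forall>x y. f x y \<^bold>\<longrightarrow> elem X x \<^bold>\<and> elem Y y) \<^bold>\<and>
     (\<^bold>\<forall>x x' y y'. f x y \<^bold>\<and> elem X x' \<^bold>\<and> eql X x x' \<^bold>\<and> elem Y y' \<^bold>\<and> eql Y y y' \<^bold>\<longrightarrow> f x' y') \<^bold>\<and>
     (\<^bold>\<forall>x. elem X x \<^bold>\<longrightarrow> (\<^bold>\<exists>y. f x y)) \<^bold>\<and>
     (\<^bold>\<forall>x y y'. f x y \<^bold>\<and> f x y' \<^bold>\<longrightarrow> eql Y y y'))"

definition direct_image ::
    "('a \<Rightarrow> 'b \<Rightarrow> 'h::complete_heyting_algebra) \<Rightarrow> ('a \<Rightarrow> 'h) \<Rightarrow> ('b \<Rightarrow> 'h)"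
  where "direct_image f S = (\<lambda>y. \<^bold>\<exists>x. S x \<^bold>\<and> f x y)"


section \<open>Domain theory\<close>

definition is_directed ::
    "('a, 'h::complete_heyting_algebra, 'z) hposet_scheme \<Rightarrow> ('a \<Rightarrow> 'h) \<Rightarrow> 'h"
  where "is_directed D S =
    (is_subset D S \<^bold>\<and> (\<^bold>\<exists>x. S x) \<^bold>\<and>
     (\<^bold>\<forall>x y. S x \<^bold>\<and> S y \<^bold>\<longrightarrow> (\<^bold>\<exists>z. S z \<^bold>\<and> leq D x z \<^bold>\<and> leq D y z)))"

definition is_sup ::
    "('a, 'h::complete_heyting_algebra, 'z) hposet_scheme \<Rightarrow> ('a \<Rightarrow> 'h) \<Rightarrow> 'a \<Rightarrow> 'h"
  where "is_sup D S s =
    (elem D s \<^bold>\<and> (\<^bold>\<forall>x. S x \<^bold>\<longrightarrow> leq D x s) \<^bold>\<and>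
     (\<^bold>\<forall>t. elem D t \<^bold>\<and> (\<^bold>\<forall>x. S x \<^bold>\<longrightarrow> leq D x t) \<^bold>\<longrightarrow> leq D s t))"

definition is_scott_continuous ::
    "('a, 'h::complete_heyting_algebra, 'y) hposet_scheme \<Rightarrow> ('b, 'h, 'z) hposet_scheme
      \<Rightarrow> ('a \<Rightarrow> 'b \<Rightarrow> 'h) \<Rightarrow> 'h"
  where "is_scott_continuous D E f =
    (is_function D E f \<^bold>\<and>
     (\<^bold>\<forall>S s y. is_directed D S \<^bold>\<and> is_sup D S s \<^bold>\<and> f s y \<^bold>\<longrightarrow> is_sup E (direct_image f S) y))"

definition exponential ::
    "('a, 'h::complete_heyting_algebra, 'y) hposet_scheme \<Rightarrow> ('b, 'h, 'z) hposet_scheme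
      \<Rightarrow> ('a \<Rightarrow> 'b \<Rightarrow> 'h, 'h) hposet"
  where "exponential D E =
    \<lparr>elem = is_scott_continuous D E,
     eql = (\<lambda>f g. \<^bold>\<forall>x y. f x y \<^bold>\<longleftrightarrow> g x y),
     leq = (\<lambda>f g. \<^bold>\<forall>x y y'. f x y \<^bold>\<and> g x y' \<^bold>\<longrightarrow> leq E y y')\<rparr>"

definition lifting ::
    "('a, 'h::complete_heyting_algebra, 'z) hset_scheme \<Rightarrow> ('a \<Rightarrow> 'h, 'h) hposet"
  where "lifting X =
    \<lparr>elem = (\<lambda>S. is_subset X S \<^bold>\<and> (\<^bold>\<forall>a b. S a \<^bold>\<and> S b \<^bold>\<longrightarrow> eql X a b)),
     eql = (\<lambda>S T. \<^bold>\<forall>x. S x \<^bold>\<longleftrightarrow> T x),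
     leq = (\<lambda>S T. \<^bold>\<forall>x. S x \<^bold>\<longrightarrow> T x)\<rparr>"

text \<open>The graph of the map \<open>S \<mapsto> f[S]\<close> from the lifting of \<open>X\<close> to the lifting of \<open>Y\<close>.\<close>

definition lifting_map ::
    "('a, 'h::complete_heyting_algebra, 'y) hset_scheme \<Rightarrow> ('b, 'h, 'z) hset_scheme
      \<Rightarrow> ('a \<Rightarrow> 'b \<Rightarrow> 'h) \<Rightarrow> (('a \<Rightarrow> 'h) \<Rightarrow> ('b \<Rightarrow> 'h) \<Rightarrow> 'h)"
  where "lifting_map X Y f = (\<lambda>S T.
    elem (lifting X) S \<^bold>\<and> elem (lifting Y) T \<^bold>\<and> eql (lifting Y) T (direct_image f S))"

definition way_below ::
    "('a, 'h::complete_heyting_algebra, 'z) hposet_scheme \<Rightarrow> 'a \<Rightarrow> 'a \<Rightarrow> 'h"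
  where "way_below D x y =
    (\<^bold>\<forall>S s. is_directed D S \<^bold>\<and> is_sup D S s \<^bold>\<and> leq D y s \<^bold>\<longrightarrow> (\<^bold>\<exists>t. S t \<^bold>\<and> leq D x t))"

definition is_sharp ::
    "('a, 'h::complete_heyting_algebra, 'z) hposet_scheme \<Rightarrow> 'a \<Rightarrow> 'h"
  where "is_sharp D x =
    (\<^bold>\<forall>u v. elem D u \<^bold>\<and> elem D v \<^bold>\<and> way_below D u v \<^bold>\<longrightarrow> way_below D u x \<^bold>\<or> \<^bold>\<not> leq D v x)"

definition is_maximal ::
    "('a, 'h::complete_heyting_algebra, 'z) hposet_scheme \<Rightarrow> 'a \<Rightarrow> 'h"
  where "is_maximal D x = (\<^bold>\<forall>y. elem D y \<^bold>\<and> leq D x y \<^bold>\<longrightarrow> leq D y x)"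


section \<open>The embedding of Cantor space\<close>

abbreviation hnat :: "(nat, 'h::complete_heyting_algebra) hset"
  where "hnat \<equiv> discrete"

abbreviation htwo :: "(bool, 'h::complete_heyting_algebra) hset"
  where "htwo \<equiv> discrete"

definition cantor_domain ::
    "((nat \<Rightarrow> 'h) \<Rightarrow> (bool \<Rightarrow> 'h) \<Rightarrow> 'h, 'h::complete_heyting_algebra) hposet"
  where "cantor_domain = exponential (lifting hnat) (lifting htwo)"

definition epsilon ::
    "(nat \<Rightarrow> bool \<Rightarrow> 'h) \<Rightarrow> ((nat \<Rightarrow> 'h) \<Rightarrow> (bool \<Rightarrow> 'h) \<Rightarrow> 'h::complete_heyting_algebra)"
  where "epsilon \<alpha> = lifting_map hnat htwo \<alpha>"

definition in_image_epsilon ::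
    "((nat \<Rightarrow> 'h) \<Rightarrow> (bool \<Rightarrow> 'h) \<Rightarrow> 'h) \<Rightarrow> 'h::complete_heyting_algebra"
  where "in_image_epsilon f =
    (\<^bold>\<exists>\<alpha>. is_function hnat htwo \<alpha> \<^bold>\<and> eql cantor_domain f (epsilon \<alpha>))"

end

theory Submission
  imports Defs
begin

text \<open>
  A Scott continuous map from the lifting of the naturals to the lifting of \<open>{0, 1}\<close> is
  determined by its values at \<open>\<emptyset>\<close> and at the singletons, and any family of values that are
  all above the one at \<open>\<emptyset>\<close> arises in this way. So \<open>v\<close> is the directed supremum of
  the maps generated by the finite lists of facts ``\<open>b\<close> belongs to the \<open>i\<close>-th value'' that
  hold of \<open>v\<close>, and \<open>u \<lless> v\<close> puts such a finite map between \<open>u\<close> and \<open>v\<close>. Finite maps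
  are compact, so if it is decidable which of these facts hold of \<open>x\<close>, then \<open>x\<close> is sharp. This
  covers the image of \<open>\<epsilon>\<close>, whose members are \<open>\<emptyset>\<close> at \<open>\<emptyset>\<close> and decided at every
  singleton, and also the least map, which is not in the image. The image under \<open>\<epsilon>\<close> of the
  zero sequence is not maximal because the constant map with value \<open>{0}\<close> lies above it.

  Validity is handled by forcing over the Heyting algebra: \<open>r \<le> p\<close> is read as
  ``\<open>r\<close> forces \<open>p\<close>''.
\<close>

section \<open>Forcing\<close>

lemma le_hall: "r \<le> (\<^bold>\<forall>x. P x) \<longleftrightarrow> (\<forall>x. r \<le> P x)"
  by (simp add: hall_def le_INF_iff)

lemma le_hand: "r \<le> (p \<^bold>\<and> q) \<longleftrightarrow> r \<le> p \<and> r \<le> q"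
  by (simp add: hand_def)

text \<open>Implication is forced as in Kripke semantics, by quantifying over the stages below
  \<open>r\<close>. By adjointness everything is decided at the single stage \<open>inf r p\<close>,
  but this form lets a goal be worked through one stage at a time.\<close>

lemma le_himp: "r \<le> (p \<^bold>\<longrightarrow> q) \<longleftrightarrow> (\<forall>s\<le>r. s \<le> p \<longrightarrow> s \<le> q)"
  unfolding himp_adjoint by (meson inf.cobounded1 inf.cobounded2 inf.boundedI order_trans order_refl)

lemma le_mp: "r \<le> (p \<^bold>\<longrightarrow> q) \<Longrightarrow> r \<le> p \<Longrightarrow> r \<le> q"
  by (simp add: le_himp)

lemma le_hnot: "r \<le> (\<^bold>\<not> p) \<longleftrightarrow> (\<forall>s\<le>r. s \<le> p \<longrightarrow> s = bot)"
  by (simp add: hnot_def le_himp bot_unique)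

lemma le_hiff: "r \<le> (p \<^bold>\<longleftrightarrow> q) \<longleftrightarrow> (\<forall>s\<le>r. s \<le> p \<longleftrightarrow> s \<le> q)"
  by (auto simp: hiff_def le_hand le_himp)

lemmas force = le_hall le_hand le_himp le_hiff le_hnot

lemma le_hexI: "r \<le> P x \<Longrightarrow> r \<le> (\<^bold>\<exists>x. P x)"
  unfolding hex_def by (rule SUP_upper2) auto

text \<open>There need be no witness at \<open>r\<close> itself. Distributivity writes
  \<open>r\<close> as the join of the elements \<open>inf r (P x)\<close>, and each of these is a
  stage at which the particular \<open>x\<close> is a witness; a conclusion reached at all of them
  holds at \<open>r\<close>.\<close>

lemma le_hexE:
  assumes "r \<le> (\<^bold>\<exists>x. P x)" and "\<And>x s. s \<le> r \<Longrightarrow> s \<le> P x \<Longrightarrow> s \<le> q"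
  shows "r \<le> q"
proof -
  have "r = inf r (Sup (range P))"
    using assms(1) by (simp add: hex_def inf.absorb1)
  also have "\<dots> \<le> q"
    unfolding inf_Sup_distrib
  proof (rule Sup_least)
    fix y assume "y \<in> inf r ` range P"
    then obtain x where "y = inf r (P x)" by blast
    then show "y \<le> q" using assms(2)[of y x] by simp
  qed
  finally show ?thesis .
qed

lemma le_horI1: "r \<le> p \<Longrightarrow> r \<le> (p \<^bold>\<or> q)"
  by (simp add: hor_def le_supI1)

lemma le_horI2: "r \<le> q \<Longrightarrow> r \<le> (p \<^bold>\<or> q)"
  by (simp add: hor_def le_supI2)

lemma le_horE:
  assumes "r \<le> (p \<^bold>\<or> q)" and "\<And>s. s \<le> r \<Longrightarrow> s \<le> p \<Longrightarrow> s \<le> t" and "\<And>s. s \<le> r \<Longrightarrow> s \<le> q \<Longrightarrow> s \<le> t"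
  shows "r \<le> t"
proof -
  \<comment> \<open>A disjunction is an existential statement over \<open>bool\<close>, so the
    covering argument of \<open>le_hexE\<close> can be reused.\<close>
  have "(p \<^bold>\<or> q) = (\<^bold>\<exists>b. if b then p else q)"
    by (simp add: hor_def hex_def UNIV_bool sup_commute)
  with assms(1) have "r \<le> (\<^bold>\<exists>b. if b then p else q)" by simp
  then show ?thesis
    by (rule le_hexE) (use assms(2,3) in \<open>auto split: if_splits\<close>)
qed

section \<open>The lifting of a discrete set\<close>

text \<open>The equality of a discrete set takes only the values \<open>top\<close> and
  \<open>bot\<close>, so a stage forces \<open>a\<close> and \<open>b\<close> to be equal exactly
  when they coincide or the stage is \<open>bot\<close>. Extensionality of \<open>S\<close> is then
  automatic.\<close>

lemma le_elem_lifting: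
  "r \<le> elem (lifting discrete) S \<longleftrightarrow>
    (\<forall>s\<le>r. \<forall>a b. s \<le> S a \<longrightarrow> s \<le> S b \<longrightarrow> a = b \<or> s = bot)"
  by (auto simp: lifting_def discrete_def is_subset_def force bot_unique split: if_splits)

lemma le_eql_lifting:
  "r \<le> eql (lifting X) S T \<longleftrightarrow> (\<forall>s\<le>r. \<forall>x. s \<le> S x \<longleftrightarrow> s \<le> T x)"
  by (auto simp: lifting_def force)

lemma le_leq_lifting:
  "r \<le> leq (lifting X) S T \<longleftrightarrow> (\<forall>s\<le>r. \<forall>x. s \<le> S x \<longrightarrow> s \<le> T x)"
  by (auto simp: lifting_def force)

lemma le_liftingD: "r \<le> leq (lifting X) S T \<Longrightarrow> r \<le> S x \<Longrightarrow> r \<le> T x"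
  by (simp add: le_leq_lifting)

section \<open>Rules for directed sets and suprema\<close>

lemma directed_elem:
  assumes "r \<le> is_directed D \<S>" and "r \<le> \<S> x"
  shows "r \<le> elem D x"
proof -
  have "r \<le> (\<S> x \<^bold>\<longrightarrow> elem D x)"
    using assms(1) unfolding is_directed_def is_subset_def le_hand le_hall by blast
  then show ?thesis using assms(2) by (rule le_mp)
qed

lemma directed_inhabited: "r \<le> is_directed D \<S> \<Longrightarrow> r \<le> (\<^bold>\<exists>x. \<S> x)"
  by (simp add: is_directed_def le_hand)

lemma directed_bound:
  assumes "r \<le> is_directed D \<S>" and "r \<le> \<S> x" and "r \<le> \<S> y"
  shows "r \<le> (\<^bold>\<exists>z. \<S> z \<^bold>\<and> leq D x z \<^bold>\<and> leq D y z)"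
proof -
  have "r \<le> (\<S> x \<^bold>\<and> \<S> y \<^bold>\<longrightarrow> (\<^bold>\<exists>z. \<S> z \<^bold>\<and> leq D x z \<^bold>\<and> leq D y z))"
    using assms(1) unfolding is_directed_def le_hand le_hall by blast
  then show ?thesis using assms(2,3) by (simp add: le_mp le_hand)
qed

lemma sup_elem: "r \<le> is_sup D \<S> x \<Longrightarrow> r \<le> elem D x"
  by (simp add: is_sup_def le_hand)

lemma sup_upper: "r \<le> is_sup D \<S> x \<Longrightarrow> r \<le> \<S> y \<Longrightarrow> r \<le> leq D y x"
  by (simp add: is_sup_def le_hand le_hall le_himp)

lemma sup_least:
  assumes "r \<le> is_sup D \<S> x" and "r \<le> elem D y"
    and "\<And>s z. s \<le> r \<Longrightarrow> s \<le> \<S> z \<Longrightarrow> s \<le> leq D z y"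
  shows "r \<le> leq D x y"
proof -
  have "r \<le> (elem D y \<^bold>\<and> (\<^bold>\<forall>z. \<S> z \<^bold>\<longrightarrow> leq D z y) \<^bold>\<longrightarrow> leq D x y)"
    using assms(1) unfolding is_sup_def le_hand le_hall by blast
  then show ?thesis by (rule le_mp) (use assms(2,3) in \<open>auto simp: le_hand le_hall le_himp\<close>)
qed

lemma is_subsetI:
  assumes "\<And>s x. s \<le> r \<Longrightarrow> s \<le> \<S> x \<Longrightarrow> s \<le> elem D x"
    and "\<And>s x y. s \<le> r \<Longrightarrow> s \<le> \<S> x \<Longrightarrow> s \<le> elem D y \<Longrightarrow> s \<le> eql D x y \<Longrightarrow> s \<le> \<S> y"
  shows "r \<le> is_subset D \<S>"
  unfolding is_subset_def le_hand le_hall le_himp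
proof (intro conjI allI impI; (elim conjE)?)
  fix s x y assume "s \<le> r" "s \<le> \<S> x" "s \<le> elem D y" "s \<le> eql D x y"
  then show "s \<le> \<S> y" by (rule assms(2)[of s x y])
qed (use assms(1) in blast)

lemma is_directedI:
  assumes "r \<le> is_subset D \<S>" and "r \<le> (\<^bold>\<exists>x. \<S> x)"
    and "\<And>s x y. s \<le> r \<Longrightarrow> s \<le> \<S> x \<Longrightarrow> s \<le> \<S> y
      \<Longrightarrow> s \<le> (\<^bold>\<exists>z. \<S> z \<^bold>\<and> leq D x z \<^bold>\<and> leq D y z)"
  shows "r \<le> is_directed D \<S>"
  unfolding is_directed_def le_hand le_hall le_himp
proof (intro conjI allI impI; (elim conjE)?)
  fix s x y assume "s \<le> r" "s \<le> \<S> x" "s \<le> \<S> y"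
  then show "s \<le> (\<^bold>\<exists>z. \<S> z \<^bold>\<and> leq D x z \<^bold>\<and> leq D y z)" by (rule assms(3)[of s x y])
qed (fact assms(1,2))+

lemma is_supI:
  assumes "r \<le> elem D x" and "\<And>s y. s \<le> r \<Longrightarrow> s \<le> \<S> y \<Longrightarrow> s \<le> leq D y x"
    and "\<And>s z. s \<le> r \<Longrightarrow> s \<le> elem D z \<Longrightarrow> (\<And>t y. t \<le> s \<Longrightarrow> t \<le> \<S> y \<Longrightarrow> t \<le> leq D y z)
      \<Longrightarrow> s \<le> leq D x z"
  shows "r \<le> is_sup D \<S> x"
  unfolding is_sup_def le_hand le_hall le_himp
proof (intro conjI allI impI; (elim conjE)?)
  fix s z assume "s \<le> r" "s \<le> elem D z" "\<forall>y. \<forall>t\<le>s. t \<le> \<S> y \<longrightarrow> t \<le> leq D y z"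
  then show "s \<le> leq D x z" using assms(3)[of s z] by blast
qed (use assms(1,2) in blast)+

text \<open>\<open>is_sup\<close> gives only a universal property. The union \<open>U\<close> of the
  members is itself subsingleton, since two of its elements lie together in a common upper bound. So
  it is an upper bound in the lifting, and leastness puts \<open>S\<close> inside it.\<close>

lemma sup_lifting_le_union:
  assumes dir: "r \<le> is_directed (lifting discrete) \<S>"
    and sup: "r \<le> is_sup (lifting discrete) \<S> S" and "r \<le> S x"
  shows "r \<le> (\<^bold>\<exists>T. \<S> T \<^bold>\<and> T x)"
proof -
  define U where "U = (\<lambda>x. \<^bold>\<exists>T. \<S> T \<^bold>\<and> T x)"
  have "a = b \<or> s = bot" if s: "s \<le> r" "s \<le> U a" "s \<le> U b" for s a b
  proof (rule ccontr)
    assume "\<not> (a = b \<or> s = bot)"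
    moreover have "s \<le> bot" if "a \<noteq> b"
      using s(2) unfolding U_def
    proof (rule le_hexE)
      fix T s1 assume 1: "s1 \<le> s" "s1 \<le> (\<S> T \<^bold>\<and> T a)"
      then have "s1 \<le> U b" using s(3) by order
      then show "s1 \<le> bot" unfolding U_def
      proof (rule le_hexE)
        fix T' s2 assume 2: "s2 \<le> s1" "s2 \<le> (\<S> T' \<^bold>\<and> T' b)"
        have d: "s2 \<le> is_directed (lifting discrete) \<S>" using dir s 1 2 by order
        have 3: "s2 \<le> \<S> T" "s2 \<le> T a" "s2 \<le> \<S> T'" "s2 \<le> T' b"
          using 1 2 by (auto simp: force)
        show "s2 \<le> bot"
        proof (rule le_hexE[OF directed_bound[OF d, OF 3(1) 3(3)]])
          fix V s3 assume 4: "s3 \<le> s2"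
            "s3 \<le> (\<S> V \<^bold>\<and> leq (lifting discrete) T V \<^bold>\<and> leq (lifting discrete) T' V)"
          have "s3 \<le> elem (lifting discrete) V"
            by (rule directed_elem[OF order_trans[OF 4(1) d]]) (use 4 in \<open>simp add: le_hand\<close>)
          moreover have "s3 \<le> V a"
            by (rule le_liftingD[of s3 discrete T]) (use 3 4 in \<open>auto simp: le_hand\<close>)
          moreover have "s3 \<le> V b"
            by (rule le_liftingD[of s3 discrete T']) (use 3 4 in \<open>auto simp: le_hand\<close>)
          ultimately show "s3 \<le> bot" using that by (auto simp: le_elem_lifting)
        qed
      qed
    qed
    ultimately show False by (simp add: bot_unique)
  qed
  then have "r \<le> elem (lifting discrete) U" by (auto simp: le_elem_lifting)
  moreover have "s \<le> leq (lifting discrete) T U" if "s \<le> \<S> T" for s T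
    unfolding le_leq_lifting
  proof (intro allI impI)
    fix t x assume "t \<le> s" "t \<le> T x"
    then have "t \<le> (\<S> T \<^bold>\<and> T x)" using that by (simp add: le_hand)
    then show "t \<le> U x" unfolding U_def by - (rule le_hexI[where x=T])
  qed
  ultimately have "r \<le> leq (lifting discrete) S U" by (intro sup_least[OF sup])
  with assms(3) show ?thesis by (simp add: le_leq_lifting U_def)
qed

section \<open>Functions between liftings\<close>

abbreviation "LN \<equiv> lifting hnat"
abbreviation "L2 \<equiv> lifting htwo"

text \<open>A function is a relation between subsets, so \<open>f\<close> applied to
  \<open>S\<close> is not a term. The union of all \<open>T\<close> related to \<open>S\<close>
  names the value without choosing one.\<close>

definition val :: "('a \<Rightarrow> ('b \<Rightarrow> 'h) \<Rightarrow> 'h) \<Rightarrow> 'a \<Rightarrow> 'b \<Rightarrow> 'h::complete_heyting_algebra"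
  where "val f S b = (\<^bold>\<exists>T. f S T \<^bold>\<and> T b)"

lemma function_typing:
  assumes "r \<le> is_function X Y f" and "r \<le> f S T"
  shows "r \<le> elem X S" and "r \<le> elem Y T"
proof -
  have "r \<le> (f S T \<^bold>\<longrightarrow> elem X S \<^bold>\<and> elem Y T)"
    using assms(1) unfolding is_function_def le_hand le_hall by blast
  from le_mp[OF this assms(2)] show "r \<le> elem X S" and "r \<le> elem Y T"
    by (simp_all add: le_hand)
qed

lemma is_functionI:
  assumes "\<And>s S T. s \<le> r \<Longrightarrow> s \<le> f S T \<Longrightarrow> s \<le> elem X S \<and> s \<le> elem Y T"
    and "\<And>s S S' T T'. s \<le> r \<Longrightarrow> s \<le> f S T \<Longrightarrow> s \<le> elem X S' \<Longrightarrow> s \<le> eql X S S' \<Longrightarrow>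
      s \<le> elem Y T' \<Longrightarrow> s \<le> eql Y T T' \<Longrightarrow> s \<le> f S' T'"
    and "\<And>s S. s \<le> r \<Longrightarrow> s \<le> elem X S \<Longrightarrow> s \<le> (\<^bold>\<exists>T. f S T)"
    and "\<And>s S T T'. s \<le> r \<Longrightarrow> s \<le> f S T \<Longrightarrow> s \<le> f S T' \<Longrightarrow> s \<le> eql Y T T'"
  shows "r \<le> is_function X Y f"
  unfolding is_function_def le_hand le_hall le_himp
proof (intro conjI allI impI; (elim conjE)?)
  fix s S T assume "s \<le> r" "s \<le> f S T"
  then show "s \<le> elem X S" "s \<le> elem Y T" using assms(1)[of s S T] by blast+
next
  fix s S S' T T'
  assume "s \<le> r" "s \<le> f S T" "s \<le> elem X S'" "s \<le> eql X S S'" "s \<le> elem Y T'" "s \<le> eql Y T T'"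
  then show "s \<le> f S' T'" by (rule assms(2)[of s S T S' T'])
next
  fix s S assume "s \<le> r" "s \<le> elem X S"
  then show "s \<le> (\<^bold>\<exists>T. f S T)" by (rule assms(3)[of s S])
next
  fix s S T T' assume "s \<le> r" "s \<le> f S T" "s \<le> f S T'"
  then show "s \<le> eql Y T T'" by (rule assms(4)[of s S T T'])
qed

lemma function_unique:
  assumes "r \<le> is_function X Y f" and "r \<le> f S T" and "r \<le> f S T'"
  shows "r \<le> eql Y T T'"
proof -
  have "r \<le> (f S T \<^bold>\<and> f S T' \<^bold>\<longrightarrow> eql Y T T')"
    using assms(1) unfolding is_function_def le_hand le_hall by blast
  then show ?thesis by (rule le_mp) (simp add: le_hand assms(2,3))
qed

lemma function_total:
  assumes "r \<le> is_function X Y f" and "r \<le> elem X S"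
  shows "r \<le> (\<^bold>\<exists>T. f S T)"
proof -
  have "r \<le> (elem X S \<^bold>\<longrightarrow> (\<^bold>\<exists>T. f S T))"
    using assms(1) unfolding is_function_def le_hand le_hall by blast
  then show ?thesis using assms(2) by (rule le_mp)
qed

lemma function_cong:
  assumes "r \<le> is_function X Y f" and "r \<le> f S T"
    and "r \<le> elem X S'" and "r \<le> eql X S S'" and "r \<le> elem Y T'" and "r \<le> eql Y T T'"
  shows "r \<le> f S' T'"
proof -
  have "\<forall>S S' T T'. r \<le> (f S T \<^bold>\<and> elem X S' \<^bold>\<and> eql X S S' \<^bold>\<and> elem Y T' \<^bold>\<and> eql Y T T' \<^bold>\<longrightarrow> f S' T')"
    using assms(1) unfolding is_function_def le_hand le_hall by blast
  then have "r \<le> (f S T \<^bold>\<and> elem X S' \<^bold>\<and> eql X S S' \<^bold>\<and> elem Y T' \<^bold>\<and> eql Y T T' \<^bold>\<longrightarrow> f S' T')"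
    by blast
  then show ?thesis by (rule le_mp) (simp add: le_hand assms(2-))
qed

text \<open>All \<open>T'\<close> related to \<open>S\<close> are equal to \<open>T\<close>, so
  forming their union does not enlarge \<open>T\<close>.\<close>

lemma function_eq_val:
  assumes f: "r \<le> is_function X (lifting Y) f" and T: "r \<le> f S T"
  shows "r \<le> eql (lifting Y) T (val f S)"
  unfolding le_eql_lifting
proof (intro allI impI iffI)
  fix s b assume s: "s \<le> r"
  { assume "s \<le> T b"
    then show "s \<le> val f S b"
      using s T unfolding val_def by (intro le_hexI[where x=T]) (simp add: le_hand) }
  assume "s \<le> val f S b"
  then show "s \<le> T b"
    unfolding val_def
  proof (rule le_hexE)
    fix T' t assume t: "t \<le> s" "t \<le> (f S T' \<^bold>\<and> T' b)"
    have "t \<le> is_function X (lifting Y) f" "t \<le> f S T" "t \<le> f S T'" "t \<le> T' b"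
      using f T s t by (auto simp: force)
    moreover from this(1-3) have "t \<le> eql (lifting Y) T T'" by (rule function_unique[of t X _ f S])
    ultimately show "t \<le> T b" by (auto simp: le_eql_lifting)
  qed
qed

lemma elem_lifting_cong:
  assumes "r \<le> eql (lifting discrete) S T" and "r \<le> elem (lifting discrete) S"
  shows "r \<le> elem (lifting discrete) T"
  using assms by (auto simp: le_elem_lifting le_eql_lifting)

lemma eql_lifting_refl: "r \<le> eql (lifting X) S S"
  by (auto simp: le_eql_lifting)

text \<open>Totality supplies a value only locally, possibly a different one at each stage of a
  cover. The term \<open>val f S\<close> is the same at every stage and equals each local value, so
  it is a value at \<open>r\<close>; this is unique choice.\<close>

lemma function_val:
  assumes f: "r \<le> is_function (lifting discrete) (lifting discrete) f"
    and S: "r \<le> elem (lifting discrete) S"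
  shows "r \<le> f S (val f S)"
proof -
  have "r \<le> (\<^bold>\<exists>T. f S T)" by (rule function_total[OF f S])
  then show ?thesis
  proof (rule le_hexE)
    fix T s assume s: "s \<le> r" "s \<le> f S T"
    then have fs: "s \<le> is_function (lifting discrete) (lifting discrete) f" using f by order
    have e: "s \<le> eql (lifting discrete) T (val f S)" by (rule function_eq_val[OF fs, OF s(2)])
    have T: "s \<le> elem (lifting discrete) T" "s \<le> elem (lifting discrete) S"
      using function_typing[OF fs, OF s(2)] by auto
    show "s \<le> f S (val f S)"
      by (rule function_cong[OF fs, OF s(2) T(2) eql_lifting_refl elem_lifting_cong[OF e T(1)] e])
  qed
qed

section \<open>Elements of the function space as families of components\<close>

definition point :: "nat option \<Rightarrow> nat \<Rightarrow> 'h::complete_heyting_algebra"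
  where "point i m = (if i = Some m then top else bot)"

text \<open>The truth value of \<open>point i\<close> lying below \<open>S\<close>: the empty set
  always does, and {n} does to the extent that n belongs to \<open>S\<close>.\<close>

definition point_in :: "(nat \<Rightarrow> 'h) \<Rightarrow> nat option \<Rightarrow> 'h::complete_heyting_algebra"
  where "point_in S i = (case i of None \<Rightarrow> top | Some n \<Rightarrow> S n)"

text \<open>The index \<open>None\<close> stands for the value at \<open>\<emptyset>\<close>, the index \<open>Some n\<close> for the value at
  \<open>{n}\<close>.\<close>

definition component :: "((nat \<Rightarrow> 'h) \<Rightarrow> (bool \<Rightarrow> 'h) \<Rightarrow> 'h) \<Rightarrow> nat option \<Rightarrow> bool \<Rightarrow> 'h::complete_heyting_algebra"
  where "component f i = val f (point i)"

text \<open>The union of the values of the family at the points below \<open>S\<close>, that is, the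
  pointwise left Kan extension of the family from the points to the whole lifting.\<close>

definition assemble :: "(nat option \<Rightarrow> bool \<Rightarrow> 'h) \<Rightarrow> (nat \<Rightarrow> 'h) \<Rightarrow> bool \<Rightarrow> 'h::complete_heyting_algebra"
  where "assemble C S b = (\<^bold>\<exists>i. point_in S i \<^bold>\<and> C i b)"

definition cantor_map ::
    "(nat option \<Rightarrow> bool \<Rightarrow> 'h) \<Rightarrow> (nat \<Rightarrow> 'h) \<Rightarrow> (bool \<Rightarrow> 'h) \<Rightarrow> 'h::complete_heyting_algebra"
  where "cantor_map C S T = (elem LN S \<^bold>\<and> elem L2 T \<^bold>\<and> eql L2 T (assemble C S))"

text \<open>Besides typing, this is monotonicity along the order of the points: the empty set is
  below every singleton, and distinct singletons are unrelated.\<close>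

definition coherent :: "(nat option \<Rightarrow> bool \<Rightarrow> 'h) \<Rightarrow> 'h::complete_heyting_algebra"
  where "coherent C = (\<^bold>\<forall>i. elem L2 (C i) \<^bold>\<and> leq L2 (C None) (C i))"

lemma le_coherent:
  "r \<le> coherent C \<longleftrightarrow> (\<forall>i. r \<le> elem L2 (C i) \<and> r \<le> leq L2 (C None) (C i))"
  by (auto simp: coherent_def force)

lemma elem_point: "r \<le> elem LN (point i)"
  by (auto simp: le_elem_lifting point_def bot_unique)

lemma point_in_le: "r \<le> point_in S i \<Longrightarrow> r \<le> leq LN (point i) S"
  by (auto simp: le_leq_lifting point_def point_in_def bot_unique split: option.splits if_splits)

lemma point_in_mono: "r \<le> leq LN S T \<Longrightarrow> r \<le> point_in S i \<Longrightarrow> r \<le> point_in T i"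
  by (auto simp: le_leq_lifting point_in_def split: option.splits)

lemma le_assembleI: "r \<le> point_in S i \<Longrightarrow> r \<le> C i b \<Longrightarrow> r \<le> assemble C S b"
  unfolding assemble_def by (rule le_hexI[where x=i]) (simp add: le_hand)

lemma le_assembleE:
  assumes "r \<le> assemble C S b" and "\<And>i s. s \<le> r \<Longrightarrow> s \<le> point_in S i \<Longrightarrow> s \<le> C i b \<Longrightarrow> s \<le> q"
  shows "r \<le> q"
  using assms unfolding assemble_def by (auto simp: le_hand elim!: le_hexE)

lemma assemble_mono:
  assumes "\<And>i. r \<le> leq L2 (C i) (C' i)"
  shows "r \<le> leq L2 (assemble C S) (assemble C' S)"
  unfolding le_leq_lifting
proof (intro allI impI)
  fix s b assume s: "s \<le> r" "s \<le> assemble C S b"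
  show "s \<le> assemble C' S b"
  proof (rule le_assembleE[OF s(2)])
    fix i t assume t: "t \<le> s" "t \<le> point_in S i" "t \<le> C i b"
    have "t \<le> leq L2 (C i) (C' i)" by (rule order_trans[OF _ assms]) (use s t in order)
    then have "t \<le> C' i b" using t(3) by (rule le_liftingD)
    with t(2) show "t \<le> assemble C' S b" by (rule le_assembleI)
  qed
qed

lemma assemble_mono_arg:
  assumes "r \<le> leq LN S S'"
  shows "r \<le> leq L2 (assemble C S) (assemble C S')"
  unfolding le_leq_lifting
proof (intro allI impI)
  fix s b assume s: "s \<le> r" "s \<le> assemble C S b"
  show "s \<le> assemble C S' b"
  proof (rule le_assembleE[OF s(2)])
    fix i t assume t: "t \<le> s" "t \<le> point_in S i" "t \<le> C i b"
    have "t \<le> leq LN S S'" by (rule order_trans[OF _ assms]) (use s t in order)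
    then have "t \<le> point_in S' i" using t(2) by (rule point_in_mono)
    then show "t \<le> assemble C S' b" using t(3) by (rule le_assembleI)
  qed
qed

text \<open>Only \<open>None\<close> and \<open>i\<close> index points below \<open>point i\<close>,
  and coherence puts the value at \<open>None\<close> inside the value at \<open>i\<close>.\<close>

lemma assemble_point:
  assumes C: "r \<le> coherent C"
  shows "r \<le> eql L2 (assemble C (point i)) (C i)"
  unfolding le_eql_lifting
proof (intro allI impI iffI)
  fix s b assume s: "s \<le> r"
  { assume "s \<le> assemble C (point i) b"
    then show "s \<le> C i b"
    proof (rule le_assembleE)
      fix j t assume t: "t \<le> s" "t \<le> point_in (point i) j" "t \<le> C j b"
      have "t \<le> leq L2 (C None) (C i)" using C s t(1) unfolding le_coherent by (meson order_trans)
      then show "t \<le> C i b"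
        using t by (cases j) (auto simp: point_in_def point_def le_leq_lifting bot_unique split: if_splits)
    qed }
  assume "s \<le> C i b"
  then show "s \<le> assemble C (point i) b"
    by (rule le_assembleI[rotated]) (auto simp: point_in_def point_def split: option.splits)
qed

text \<open>Two elements of the union come from points \<open>i\<close> and \<open>j\<close> below
  the same subsingleton \<open>S\<close>. Such points are comparable, so by coherence both elements
  lie in one component, which is subsingleton.\<close>

lemma elem_assemble:
  assumes C: "r \<le> coherent C" and S: "r \<le> elem LN S"
  shows "r \<le> elem L2 (assemble C S)"
  unfolding le_elem_lifting
proof (intro allI impI)
  fix s a b assume s: "s \<le> r" "s \<le> assemble C S a" "s \<le> assemble C S b"
  have "s \<le> bot" if "a \<noteq> b"
  proof (rule le_assembleE[OF s(2)])
    fix i s1 assume 1: "s1 \<le> s" "s1 \<le> point_in S i" "s1 \<le> C i a"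
    have "s1 \<le> assemble C S b" using s 1 by order
    then show "s1 \<le> bot"
    proof (rule le_assembleE)
      fix j s2 assume 2: "s2 \<le> s1" "s2 \<le> point_in S j" "s2 \<le> C j b"
      have s2: "s2 \<le> r" "s2 \<le> point_in S i" "s2 \<le> C i a" using s 1 2 by order+
      have *: "s2 = bot" if "s2 \<le> C k a" "s2 \<le> C k b" for k
        using that C s2(1) \<open>a \<noteq> b\<close> unfolding le_coherent le_elem_lifting by blast
      have **: "s2 \<le> C k c" if "s2 \<le> C None c" for k c
        using that C s2(1) unfolding le_coherent le_leq_lifting by blast
      consider "i = None" | "j = None" | n m where "i = Some n" "j = Some m"
        by (cases i; cases j) auto
      then have "s2 = bot"
      proof cases
        case 1 then show ?thesis using * ** s2 2 by blast
      next
        case 2 then show ?thesis using * ** s2 \<open>s2 \<le> C j b\<close> by blast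
      next
        case 3
        then have "n = m \<or> s2 = bot"
          using S s2 2 by (auto simp: le_elem_lifting point_in_def)
        then show ?thesis using * s2 2 3 by blast
      qed
      then show "s2 \<le> bot" by simp
    qed
  qed
  then show "a = b \<or> s = bot" by (auto simp: bot_unique)
qed

lemma cantor_map_assemble:
  assumes "r \<le> coherent C" and "r \<le> elem LN S"
  shows "r \<le> cantor_map C S (assemble C S)"
  using assms by (simp add: cantor_map_def force elem_assemble eql_lifting_refl)

lemma function_cantor_map:
  assumes C: "r \<le> coherent C"
  shows "r \<le> is_function LN L2 (cantor_map C)"
proof (rule is_functionI)
  fix t S S' T T'
  assume *: "t \<le> cantor_map C S T" "t \<le> elem LN S'" "t \<le> eql LN S S'" "t \<le> elem L2 T'" "t \<le> eql L2 T T'"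
  have "t \<le> leq LN S S'" "t \<le> leq LN S' S"
    using *(3) by (auto simp: le_eql_lifting le_leq_lifting)
  then have "t \<le> eql L2 (assemble C S) (assemble C S')"
    using assemble_mono_arg[of t S S' C] assemble_mono_arg[of t S' S C]
    by (auto simp: le_eql_lifting le_leq_lifting)
  then show "t \<le> cantor_map C S' T'" using * by (simp add: cantor_map_def le_hand le_eql_lifting)
next
  fix t S assume "t \<le> r" "t \<le> elem LN S"
  then have "t \<le> cantor_map C S (assemble C S)" using C by (intro cantor_map_assemble) order+
  then show "t \<le> (\<^bold>\<exists>T. cantor_map C S T)" by - (rule le_hexI[where x="assemble C S"])
qed (simp_all add: cantor_map_def le_hand le_eql_lifting)

section \<open>Scott continuous maps generated by coherent families\<close>

lemma elem_cantorI:
  assumes "r \<le> is_function LN L2 f"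
    and "\<And>s \<S> S T. s \<le> r \<Longrightarrow> s \<le> is_directed LN \<S> \<Longrightarrow> s \<le> is_sup LN \<S> S \<Longrightarrow> s \<le> f S T
      \<Longrightarrow> s \<le> is_sup L2 (direct_image f \<S>) T"
  shows "r \<le> elem cantor_domain f"
proof -
  have "r \<le> is_scott_continuous LN L2 f"
    unfolding is_scott_continuous_def le_hand le_hall le_himp
  proof (intro conjI allI impI; (elim conjE)?)
    fix \<S> S T s assume "s \<le> r" "s \<le> is_directed LN \<S>" "s \<le> is_sup LN \<S> S" "s \<le> f S T"
    then show "s \<le> is_sup L2 (direct_image f \<S>) T" by (rule assms(2)[of s \<S> S T])
  qed (rule assms(1))
  then show ?thesis by (simp add: cantor_domain_def exponential_def)
qed

lemma cantor_function: "r \<le> elem cantor_domain f \<Longrightarrow> r \<le> is_function LN L2 f"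
  by (simp add: cantor_domain_def exponential_def is_scott_continuous_def le_hand)

lemma cantor_sup:
  assumes "r \<le> elem cantor_domain f" and "r \<le> is_directed LN \<S>" and "r \<le> is_sup LN \<S> S" and "r \<le> f S T"
  shows "r \<le> is_sup L2 (direct_image f \<S>) T"
proof -
  have "r \<le> (is_directed LN \<S> \<^bold>\<and> is_sup LN \<S> S \<^bold>\<and> f S T \<^bold>\<longrightarrow> is_sup L2 (direct_image f \<S>) T)"
    using assms(1)
    unfolding cantor_domain_def exponential_def is_scott_continuous_def hposet.simps hset.simps le_hand le_hall
    by blast
  then show ?thesis by (rule le_mp) (simp add: le_hand assms(2-))
qed

lemma direct_imageI: "r \<le> \<S> S \<Longrightarrow> r \<le> f S T \<Longrightarrow> r \<le> direct_image f \<S> T"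
  unfolding direct_image_def by (rule le_hexI[where x=S]) (simp add: le_hand)

text \<open>The points are compact: one that lies below a directed supremum lies below a member.
  Each contribution to the value at the supremum is therefore already present in the value at some
  member.\<close>

lemma elem_cantor_map:
  assumes C: "r \<le> coherent C"
  shows "r \<le> elem cantor_domain (cantor_map C)"
proof (rule elem_cantorI[OF function_cantor_map[OF C]])
  fix s \<S> S T
  assume s: "s \<le> r" and dir: "s \<le> is_directed LN \<S>" and sup: "s \<le> is_sup LN \<S> S" and T: "s \<le> cantor_map C S T"
  have eT: "s \<le> elem L2 T" and qT: "s \<le> eql L2 T (assemble C S)"
    using T by (simp_all add: cantor_map_def le_hand)
  show "s \<le> is_sup L2 (direct_image (cantor_map C) \<S>) T"
  proof (rule is_supI[OF eT])
    fix t U assume t: "t \<le> s" "t \<le> direct_image (cantor_map C) \<S> U"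
    from t(2) show "t \<le> leq L2 U T"
      unfolding direct_image_def
    proof (rule le_hexE)
      fix V t1 assume 1: "t1 \<le> t" "t1 \<le> (\<S> V \<^bold>\<and> cantor_map C V U)"
      have "t1 \<le> is_sup LN \<S> S" using sup t 1 by order
      then have "t1 \<le> leq LN V S" by (rule sup_upper[of t1 LN \<S> S V]) (use 1 in \<open>simp add: le_hand\<close>)
      then have "t1 \<le> leq L2 (assemble C V) (assemble C S)" by (rule assemble_mono_arg)
      moreover have "t1 \<le> eql L2 T (assemble C S)" using t 1 qT by order
      moreover have "t1 \<le> eql L2 U (assemble C V)" using 1 by (simp add: cantor_map_def le_hand)
      ultimately show "t1 \<le> leq L2 U T" by (auto simp: le_leq_lifting le_eql_lifting)
    qed
  next
    fix t W
    assume t: "t \<le> s" and ub: "\<And>u U. u \<le> t \<Longrightarrow> u \<le> direct_image (cantor_map C) \<S> U \<Longrightarrow> u \<le> leq L2 U W"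
    have W: "u \<le> W b" if u: "u \<le> t" "u \<le> \<S> V" "u \<le> point_in V i" "u \<le> C i b" for u V i b
    proof -
      have "u \<le> coherent C" "u \<le> is_directed LN \<S>" using t u C dir s by order+
      then have "u \<le> cantor_map C V (assemble C V)" by (intro cantor_map_assemble directed_elem[of u LN \<S> V] u)
      then have "u \<le> direct_image (cantor_map C) \<S> (assemble C V)" by - (rule direct_imageI[of u \<S> V, OF u(2)])
      then have "u \<le> leq L2 (assemble C V) W" using ub u(1) by blast
      then show "u \<le> W b" by (rule le_liftingD) (use u in \<open>auto intro: le_assembleI\<close>)
    qed
    show "t \<le> leq L2 T W"
      unfolding le_leq_lifting
    proof (intro allI impI)
      fix u b assume u: "u \<le> t" "u \<le> T b"
      have "u \<le> assemble C S b" using u t qT by (auto simp: le_eql_lifting)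
      then show "u \<le> W b"
      proof (rule le_assembleE)
        fix i u1 assume 1: "u1 \<le> u" "u1 \<le> point_in S i" "u1 \<le> C i b"
        have d: "u1 \<le> is_directed LN \<S>" "u1 \<le> is_sup LN \<S> S" using 1 u t dir sup by order+
        \<comment> \<open>For the empty set, compactness is inhabitedness of the directed set; for a
          singleton it is the description of suprema as unions.\<close>
        have "u1 \<le> (\<^bold>\<exists>V. \<S> V \<^bold>\<and> point_in V i)"
        proof (cases i)
          case None
          then show ?thesis using directed_inhabited[OF d(1)] by (simp add: point_in_def hand_def)
        next
          case (Some n)
          then show ?thesis using sup_lifting_le_union[OF d, of n] 1 by (simp add: point_in_def)
        qed
        then show "u1 \<le> W b"
        proof (rule le_hexE)
          fix V u2 assume 2: "u2 \<le> u1" "u2 \<le> (\<S> V \<^bold>\<and> point_in V i)"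
          have "u2 \<le> t" "u2 \<le> C i b" using 1 2 u by order+
          then show "u2 \<le> W b" using W[of u2 V i b] 2 by (simp add: le_hand)
        qed
      qed
    qed
  qed
qed

lemma val_cantor_map:
  assumes "r \<le> coherent C" and "r \<le> elem LN S"
  shows "r \<le> eql L2 (assemble C S) (val (cantor_map C) S)"
  by (rule function_eq_val[OF function_cantor_map[OF assms(1)], OF cantor_map_assemble[OF assms]])

lemma component_cantor_map:
  assumes "r \<le> coherent C"
  shows "r \<le> component (cantor_map C) i b \<longleftrightarrow> r \<le> C i b"
  using val_cantor_map[OF assms elem_point[of r i]] assemble_point[OF assms, of i]
  by (simp add: component_def le_eql_lifting)

lemma elem_component:
  assumes "r \<le> elem cantor_domain f"
  shows "r \<le> elem L2 (component f i)"
proof -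
  have "r \<le> is_function LN L2 f" using assms by (rule cantor_function)
  from function_typing(2)[OF this, OF function_val[OF this elem_point]] show ?thesis
    by (simp add: component_def)
qed

text \<open>\<open>S\<close> is the directed supremum of \<open>\<emptyset>\<close> and of the singletons \<open>{n}\<close> with \<open>n \<in> S\<close>.\<close>

lemma val_eq_assemble:
  assumes f: "r \<le> elem cantor_domain f" and S: "r \<le> elem LN S"
  shows "r \<le> eql L2 (val f S) (assemble (component f) S)"
proof -
  \<comment> \<open>Subsets must respect equality, so the members are all elements equal to some
    point below \<open>S\<close>, and not only the terms \<open>point i\<close>.\<close>
  define \<S> where "\<S> = (\<lambda>T. elem LN T \<^bold>\<and> (\<^bold>\<exists>i. point_in S i \<^bold>\<and> eql LN T (point i)))"
  have fn: "r \<le> is_function LN L2 f" using f by (rule cantor_function)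
  have \<S>I: "t \<le> \<S> (point i)" if "t \<le> point_in S i" for t i
    unfolding \<S>_def le_hand
    by (intro conjI elem_point le_hexI[where x=i]) (simp add: le_hand that eql_lifting_refl)
  have dir: "r \<le> is_directed LN \<S>"
  proof (rule is_directedI)
    show "r \<le> is_subset LN \<S>"
    proof (rule is_subsetI)
      fix s T T' assume T: "s \<le> \<S> T" "s \<le> elem LN T'" "s \<le> eql LN T T'"
      from T(1) have "s \<le> (\<^bold>\<exists>i. point_in S i \<^bold>\<and> eql LN T (point i))" by (simp add: \<S>_def le_hand)
      then have "s \<le> (\<^bold>\<exists>i. point_in S i \<^bold>\<and> eql LN T' (point i))"
      proof (rule le_hexE)
        fix i t assume t: "t \<le> s" "t \<le> (point_in S i \<^bold>\<and> eql LN T (point i))"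
        then have "t \<le> eql LN T' (point i)" using T(3) by (auto simp: le_hand le_eql_lifting)
        then show "t \<le> (\<^bold>\<exists>i. point_in S i \<^bold>\<and> eql LN T' (point i))"
          by (intro le_hexI[where x=i]) (use t in \<open>simp add: le_hand\<close>)
      qed
      then show "s \<le> \<S> T'" using T by (simp add: \<S>_def le_hand)
    qed (simp add: \<S>_def le_hand)
    show "r \<le> (\<^bold>\<exists>T. \<S> T)"
      by (rule le_hexI[where x="point None"], rule \<S>I) (simp add: point_in_def)
    fix s T T' assume s: "s \<le> r" "s \<le> \<S> T" "s \<le> \<S> T'"
    from s(2) have "s \<le> (\<^bold>\<exists>i. point_in S i \<^bold>\<and> eql LN T (point i))" by (simp add: \<S>_def le_hand)
    then show "s \<le> (\<^bold>\<exists>U. \<S> U \<^bold>\<and> leq LN T U \<^bold>\<and> leq LN T' U)"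
    proof (rule le_hexE)
      fix i t assume t: "t \<le> s" "t \<le> (point_in S i \<^bold>\<and> eql LN T (point i))"
      have "t \<le> \<S> T'" using s(3) t(1) by order
      then have "t \<le> (\<^bold>\<exists>i. point_in S i \<^bold>\<and> eql LN T' (point i))" by (simp add: \<S>_def le_hand)
      then show "t \<le> (\<^bold>\<exists>U. \<S> U \<^bold>\<and> leq LN T U \<^bold>\<and> leq LN T' U)"
      proof (rule le_hexE)
        fix j u assume u: "u \<le> t" "u \<le> (point_in S j \<^bold>\<and> eql LN T' (point j))"
        have ij: "u \<le> point_in S i" "u \<le> point_in S j" "u \<le> eql LN T (point i)" "u \<le> eql LN T' (point j)"
          using t u by (auto simp: le_hand)
        have uS: "u \<le> elem LN S" using S s t u by order
        \<comment> \<open>The larger of the two points is \<open>k\<close>. If neither is empty,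
          they are singletons inside the subsingleton \<open>S\<close>, so they agree unless the
          stage is \<open>bot\<close>.\<close>
        have "\<exists>k. u \<le> point_in S k \<and> u \<le> leq LN (point i) (point k) \<and> u \<le> leq LN (point j) (point k)"
        proof (cases i)
          case None
          then show ?thesis using ij by (intro exI[of _ j]) (auto simp: le_leq_lifting point_def bot_unique)
        next
          case (Some n)
          show ?thesis
          proof (cases j)
            case None
            then show ?thesis using ij by (intro exI[of _ i]) (auto simp: le_leq_lifting point_def bot_unique)
          next
            case (Some m)
            then have "n = m \<or> u = bot"
              using uS ij \<open>i = Some n\<close> by (auto simp: le_elem_lifting point_in_def)
            then have "u \<le> leq LN (point j) (point i)"
              using \<open>i = Some n\<close> Some by (auto simp: le_leq_lifting bot_unique)
            then show ?thesis using ij by (intro exI[of _ i]) (auto simp: le_leq_lifting)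
          qed
        qed
        then obtain k where k: "u \<le> point_in S k" "u \<le> leq LN (point i) (point k)"
          "u \<le> leq LN (point j) (point k)" by blast
        have "u \<le> leq LN T (point k)" "u \<le> leq LN T' (point k)"
          using ij k by (simp_all add: le_leq_lifting le_eql_lifting)
        then show "u \<le> (\<^bold>\<exists>U. \<S> U \<^bold>\<and> leq LN T U \<^bold>\<and> leq LN T' U)"
          by (intro le_hexI[where x="point k"]) (simp add: le_hand \<S>I k)
      qed
    qed
  qed
  have sup: "r \<le> is_sup LN \<S> S"
  proof (rule is_supI[OF S])
    fix s T assume s: "s \<le> r" "s \<le> \<S> T"
    from s(2) have "s \<le> (\<^bold>\<exists>i. point_in S i \<^bold>\<and> eql LN T (point i))" by (simp add: \<S>_def le_hand)
    then show "s \<le> leq LN T S"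
    proof (rule le_hexE)
      fix i t assume t: "t \<le> s" "t \<le> (point_in S i \<^bold>\<and> eql LN T (point i))"
      then have "t \<le> leq LN (point i) S" by (intro point_in_le) (simp add: le_hand)
      then show "t \<le> leq LN T S" using t by (simp add: le_hand le_leq_lifting le_eql_lifting)
    qed
  next
    fix s T assume s: "s \<le> r" and ub: "\<And>t U. t \<le> s \<Longrightarrow> t \<le> \<S> U \<Longrightarrow> t \<le> leq LN U T"
    show "s \<le> leq LN S T"
      unfolding le_leq_lifting
    proof (intro allI impI)
      fix t n assume t: "t \<le> s" "t \<le> S n"
      then have "t \<le> \<S> (point (Some n))" by (intro \<S>I) (simp add: point_in_def)
      then have "t \<le> leq LN (point (Some n)) T" using ub t(1) by blast
      then show "t \<le> T n" by (rule le_liftingD) (simp add: point_def)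
    qed
  qed
  have fS: "r \<le> f S (val f S)" by (rule function_val[OF fn S])
  have sup': "r \<le> is_sup L2 (direct_image f \<S>) (val f S)" by (rule cantor_sup[OF f dir sup fS])
  have assemble_le: "r \<le> leq L2 (assemble (component f) S) (val f S)"
    unfolding le_leq_lifting
  proof (intro allI impI)
    fix s b assume s: "s \<le> r" "s \<le> assemble (component f) S b"
    from s(2) show "s \<le> val f S b"
    proof (rule le_assembleE)
      fix i t assume t: "t \<le> s" "t \<le> point_in S i" "t \<le> component f i b"
      have tfn: "t \<le> is_function LN L2 f" and tsup: "t \<le> is_sup L2 (direct_image f \<S>) (val f S)"
        using fn sup' s t by order+
      have "t \<le> direct_image f \<S> (component f i)"
        unfolding component_def by (rule direct_imageI[of t \<S> "point i" f, OF \<S>I[OF t(2)] function_val[OF tfn elem_point[of t i]]])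
      then have "t \<le> leq L2 (component f i) (val f S)" by (rule sup_upper[OF tsup])
      then show "t \<le> val f S b" using t(3) by (rule le_liftingD)
    qed
  qed
  \<comment> \<open>\<open>elem_assemble\<close> would ask for coherence of the components, which is
    itself derived from this lemma later. Lying below the subsingleton \<open>val f S\<close> gives
    the typing instead.\<close>
  have "r \<le> elem L2 (val f S)" by (rule sup_elem[OF sup'])
  then have "r \<le> elem L2 (assemble (component f) S)" using assemble_le by (auto simp: le_elem_lifting le_leq_lifting)
  then have "r \<le> leq L2 (val f S) (assemble (component f) S)"
  proof (rule sup_least[OF sup'])
    fix s U assume s: "s \<le> r" "s \<le> direct_image f \<S> U"
    from s(2) show "s \<le> leq L2 U (assemble (component f) S)"
      unfolding direct_image_def
    proof (rule le_hexE)
      fix T t assume t: "t \<le> s" "t \<le> (\<S> T \<^bold>\<and> f T U)"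
      then have "t \<le> (\<^bold>\<exists>i. point_in S i \<^bold>\<and> eql LN T (point i))" by (simp add: \<S>_def le_hand)
      then show "t \<le> leq L2 U (assemble (component f) S)"
      proof (rule le_hexE)
        fix i u assume u: "u \<le> t" "u \<le> (point_in S i \<^bold>\<and> eql LN T (point i))"
        have ufn: "u \<le> is_function LN L2 f" using fn s t u by order
        have TU: "u \<le> f T U" using t u by (auto simp: le_hand)
        have "u \<le> elem L2 U" using function_typing(2)[OF ufn, OF TU] .
        then have "u \<le> f (point i) U"
          using function_cong[OF ufn, OF TU elem_point _ _ eql_lifting_refl] u by (simp add: le_hand)
        then have "u \<le> eql L2 U (component f i)"
          unfolding component_def by (rule function_eq_val[OF ufn])
        then show "u \<le> leq L2 U (assemble (component f) S)"
          using u by (auto simp: le_hand le_eql_lifting le_leq_lifting intro!: le_assembleI[of _ S i])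
      qed
    qed
  qed
  then show ?thesis using assemble_le by (auto simp: le_eql_lifting le_leq_lifting)
qed

section \<open>Order and directed suprema in terms of components\<close>

lemma le_leq_cantor:
  "r \<le> leq cantor_domain f g \<longleftrightarrow>
    (\<forall>s\<le>r. \<forall>S T T'. s \<le> f S T \<longrightarrow> s \<le> g S T' \<longrightarrow> s \<le> leq L2 T T')"
  by (simp add: cantor_domain_def exponential_def le_hall le_himp le_hand) blast

lemma le_eql_cantor:
  "r \<le> eql cantor_domain f g \<longleftrightarrow> (\<forall>s\<le>r. \<forall>S T. s \<le> f S T \<longleftrightarrow> s \<le> g S T)"
  by (simp add: cantor_domain_def exponential_def le_hall le_hiff) blast

lemma cantor_val: "r \<le> elem cantor_domain f \<Longrightarrow> r \<le> elem LN S \<Longrightarrow> r \<le> f S (val f S)"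
  by (rule function_val[OF cantor_function])

lemma cantor_leqD:
  assumes "r \<le> leq cantor_domain f g" and "r \<le> elem cantor_domain f" and "r \<le> elem cantor_domain g"
  shows "r \<le> leq L2 (component f i) (component g i)"
  using assms(1) cantor_val[OF assms(2) elem_point] cantor_val[OF assms(3) elem_point]
  unfolding le_leq_cantor component_def by blast

text \<open>Both maps are assembled from their components, and \<open>assemble\<close> is monotone
  in the family.\<close>

lemma cantor_leqI:
  assumes f: "r \<le> elem cantor_domain f" and g: "r \<le> elem cantor_domain g"
    and le: "\<And>i. r \<le> leq L2 (component f i) (component g i)"
  shows "r \<le> leq cantor_domain f g"
  unfolding le_leq_cantor
proof (intro allI impI)
  fix s S T T' assume s: "s \<le> r" "s \<le> f S T" "s \<le> g S T'"
  have fg: "s \<le> elem cantor_domain f" "s \<le> elem cantor_domain g" using f g s by order+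
  then have fn: "s \<le> is_function LN L2 f" "s \<le> is_function LN L2 g" by (auto intro: cantor_function)
  have S: "s \<le> elem LN S" using function_typing(1)[OF fn(1), OF s(2)] .
  have "s \<le> leq L2 (component f i) (component g i)" for i using le[of i] s(1) by order
  then have "s \<le> leq L2 (assemble (component f) S) (assemble (component g) S)" by (rule assemble_mono)
  then show "s \<le> leq L2 T T'"
    using val_eq_assemble[OF fg(1) S] val_eq_assemble[OF fg(2) S]
      function_eq_val[OF fn(1), OF s(2)] function_eq_val[OF fn(2), OF s(3)]
    by (simp add: le_leq_lifting le_eql_lifting)
qed

text \<open>Monotonicity of \<open>f\<close> is read off \<open>val_eq_assemble\<close>: the index
  \<open>None\<close> contributes to the union that describes the value at any point.\<close>

lemma coherent_component:
  assumes "r \<le> elem cantor_domain f"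
  shows "r \<le> coherent (component f)"
  unfolding le_coherent
proof (intro allI conjI elem_component[OF assms])
  fix i show "r \<le> leq L2 (component f None) (component f i)"
    using val_eq_assemble[OF assms elem_point[of r i]]
    by (auto simp: component_def[of f i] le_eql_lifting le_leq_lifting point_in_def intro!: le_assembleI[where i=None])
qed

lemma component_cong:
  assumes "r \<le> eql cantor_domain f g"
  shows "r \<le> eql L2 (component f i) (component g i)"
proof -
  have mono: "s \<le> val h S b"
    if "s \<le> val h' S b" "\<forall>t\<le>s. \<forall>S T. t \<le> h' S T \<longrightarrow> t \<le> h S T"
    for s S b and h h' :: "(nat \<Rightarrow> 'a) \<Rightarrow> (bool \<Rightarrow> 'a) \<Rightarrow> 'a"
    using that(1) unfolding val_def[of h']
  proof (rule le_hexE)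
    fix T t assume "t \<le> s" "t \<le> (h' S T \<^bold>\<and> T b)"
    then show "t \<le> val h S b"
      unfolding val_def using that(2) by (intro le_hexI[where x=T]) (simp add: le_hand)
  qed
  show ?thesis
    unfolding le_eql_lifting component_def
  proof (intro allI impI)
    fix s b assume "s \<le> r"
    then have "\<forall>t\<le>s. \<forall>S T. t \<le> f S T \<longleftrightarrow> t \<le> g S T"
      using assms unfolding le_eql_cantor by (meson order_trans)
    then show "s \<le> val f (point i) b \<longleftrightarrow> s \<le> val g (point i) b"
      using mono[of s f "point i" b g] mono[of s g "point i" b f] by blast
  qed
qed

text \<open>Directed suprema are formed in each component as unions. The unions \<open>C\<close> are
  a coherent family, \<open>cantor_map C\<close> is an upper bound, and leastness puts
  \<open>f\<close> below it.\<close>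

lemma cantor_component_sup:
  assumes dir: "r \<le> is_directed cantor_domain \<S>" and sup: "r \<le> is_sup cantor_domain \<S> f"
    and b: "r \<le> component f i b"
  shows "r \<le> (\<^bold>\<exists>g. \<S> g \<^bold>\<and> component g i b)"
proof -
  define C where "C = (\<lambda>i b. \<^bold>\<exists>g. \<S> g \<^bold>\<and> component g i b)"
  have CI: "s \<le> C i b" if "s \<le> \<S> g" "s \<le> component g i b" for s g i b
    unfolding C_def by (rule le_hexI[where x=g]) (simp add: le_hand that)
  have mem: "s \<le> elem cantor_domain g" if "s \<le> r" "s \<le> \<S> g" for s g
    by (rule directed_elem[OF order_trans[OF that(1) dir], OF that(2)])
  have C: "r \<le> coherent C"
    unfolding le_coherent
  proof (intro allI conjI)
    fix i
    have "s \<le> bot" if s: "s \<le> r" "s \<le> C i a" "s \<le> C i b" "a \<noteq> b" for s a b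
      using s(2) unfolding C_def
    proof (rule le_hexE)
      fix g s1 assume 1: "s1 \<le> s" "s1 \<le> (\<S> g \<^bold>\<and> component g i a)"
      have "s1 \<le> C i b" using s 1 by order
      then show "s1 \<le> bot" unfolding C_def
      proof (rule le_hexE)
        fix h s2 assume 2: "s2 \<le> s1" "s2 \<le> (\<S> h \<^bold>\<and> component h i b)"
        have d: "s2 \<le> is_directed cantor_domain \<S>" using dir s 1 2 by order
        have 3: "s2 \<le> \<S> g" "s2 \<le> component g i a" "s2 \<le> \<S> h" "s2 \<le> component h i b" "s2 \<le> r"
          using s 1 2 by (auto simp: le_hand)
        show "s2 \<le> bot"
        proof (rule le_hexE[OF directed_bound[OF d, OF 3(1) 3(3)]])
          fix k s3 assume 4: "s3 \<le> s2" "s3 \<le> (\<S> k \<^bold>\<and> leq cantor_domain g k \<^bold>\<and> leq cantor_domain h k)"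
          have r3: "s3 \<le> r" "s3 \<le> \<S> k" "s3 \<le> \<S> g" "s3 \<le> \<S> h" "s3 \<le> component g i a" "s3 \<le> component h i b"
            using 3 4 by (auto simp: le_hand)
          have el: "s3 \<le> elem cantor_domain k" "s3 \<le> elem cantor_domain g" "s3 \<le> elem cantor_domain h"
            using mem r3 by blast+
          have "s3 \<le> component k i a" using cantor_leqD[of s3 g k i] el 4 r3 by (auto simp: le_hand intro: le_liftingD)
          moreover have "s3 \<le> component k i b" using cantor_leqD[of s3 h k i] el 4 r3 by (auto simp: le_hand intro: le_liftingD)
          ultimately show "s3 \<le> bot" using elem_component[OF el(1), of i] s(4) by (auto simp: le_elem_lifting)
        qed
      qed
    qed
    then show "r \<le> elem L2 (C i)" unfolding le_elem_lifting by (metis bot_unique)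
    show "r \<le> leq L2 (C None) (C i)"
      unfolding le_leq_lifting
    proof (intro allI impI)
      fix s b assume s: "s \<le> r" "s \<le> C None b"
      from s(2) show "s \<le> C i b" unfolding C_def
      proof (rule le_hexE)
        fix g t assume t: "t \<le> s" "t \<le> (\<S> g \<^bold>\<and> component g None b)"
        then have g: "t \<le> \<S> g" "t \<le> component g None b" "t \<le> r" using s by (auto simp: le_hand)
        have "t \<le> leq L2 (component g None) (component g i)"
          using coherent_component[OF mem[OF g(3) g(1)]] by (simp add: le_coherent)
        then have "t \<le> component g i b" using g(2) by (rule le_liftingD)
        with g(1) show "t \<le> (\<^bold>\<exists>g. \<S> g \<^bold>\<and> component g i b)" by (rule CI[unfolded C_def])
      qed
    qed
  qed
  have "r \<le> leq cantor_domain f (cantor_map C)"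
  proof (rule sup_least[OF sup elem_cantor_map[OF C]])
    fix s g assume s: "s \<le> r" "s \<le> \<S> g"
    have sC: "s \<le> coherent C" using s C by order
    show "s \<le> leq cantor_domain g (cantor_map C)"
    proof (rule cantor_leqI[OF mem[OF s] elem_cantor_map[OF sC]])
      fix i show "s \<le> leq L2 (component g i) (component (cantor_map C) i)"
        unfolding le_leq_lifting
      proof (intro allI impI)
        fix t b assume t: "t \<le> s" "t \<le> component g i b"
        have "t \<le> \<S> g" "t \<le> coherent C" using s t sC by order+
        then show "t \<le> component (cantor_map C) i b" using CI t(2) by (simp add: component_cantor_map)
      qed
    qed
  qed
  then have "r \<le> leq L2 (component f i) (component (cantor_map C) i)"
    by (rule cantor_leqD[OF _ sup_elem[OF sup] elem_cantor_map[OF C]])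
  from le_liftingD[OF this, OF b] have "r \<le> C i b" by (simp add: component_cantor_map[OF C])
  then show ?thesis by (simp add: C_def)
qed

section \<open>Finite elements and sharpness\<close>

text \<open>A fact at \<open>None\<close> is copied to every index, as coherence demands of the
  family generated by the list.\<close>

definition info :: "(nat option \<times> bool) list \<Rightarrow> nat option \<Rightarrow> bool \<Rightarrow> 'h::complete_heyting_algebra"
  where "info F i b = (if (i, b) \<in> set F \<or> (None, b) \<in> set F then top else bot)"

text \<open>An inconsistent list generates no element of the domain; this does no harm because it holds
  of an element only where \<open>bot\<close> does. Hence lists are joined by appending, without a
  consistency check.\<close>

definition holds ::
    "(nat option \<times> bool) list \<Rightarrow> ((nat \<Rightarrow> 'h) \<Rightarrow> (bool \<Rightarrow> 'h) \<Rightarrow> 'h) \<Rightarrow> 'h::complete_heyting_algebra"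
  where "holds F f = (INF p\<in>set F. component f (fst p) (snd p))"

lemma le_holds: "r \<le> holds F f \<longleftrightarrow> (\<forall>(i, b) \<in> set F. r \<le> component f i b)"
  by (auto simp: holds_def le_INF_iff)

lemma info_le:
  assumes f: "r \<le> elem cantor_domain f" and F: "r \<le> holds F f"
  shows "r \<le> leq L2 (info F i) (component f i)"
  unfolding le_leq_lifting
proof (intro allI impI)
  fix s b assume s: "s \<le> r" "s \<le> info F i b"
  consider "s = bot" | "(i, b) \<in> set F" | "(None, b) \<in> set F"
    using s(2) by (auto simp: info_def bot_unique split: if_splits)
  then show "s \<le> component f i b"
  proof cases
    case 1 then show ?thesis by simp
  next
    case 2 then show ?thesis using F s(1) by (auto simp: le_holds)
  next
    case 3
    then have "s \<le> component f None b" using F s(1) by (auto simp: le_holds)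
    moreover have "r \<le> leq L2 (component f None) (component f i)"
      using coherent_component[OF f] by (simp add: le_coherent)
    ultimately show ?thesis using s(1) by (simp add: le_leq_lifting)
  qed
qed

text \<open>Consistency of the list is inherited from \<open>f\<close>: each \<open>info F i\<close>
  lies inside \<open>component f i\<close>, which is subsingleton.\<close>

lemma coherent_info:
  assumes f: "r \<le> elem cantor_domain f" and F: "r \<le> holds F f"
  shows "r \<le> coherent (info F)"
  unfolding le_coherent
proof (intro allI conjI)
  fix i
  show "r \<le> elem L2 (info F i)"
    using elem_component[OF f, of i] info_le[OF f F, of i] by (simp add: le_elem_lifting le_leq_lifting)
  show "r \<le> leq L2 (info F None) (info F i)"
    by (auto simp: le_leq_lifting info_def)
qed

lemma finite_below:
  assumes f: "r \<le> elem cantor_domain f" and F: "r \<le> holds F f"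
  shows "r \<le> leq cantor_domain (cantor_map (info F)) f"
  by (rule cantor_leqI[OF elem_cantor_map[OF coherent_info[OF f F]] f])
    (use info_le[OF f F] in \<open>auto simp: le_leq_lifting component_cantor_map[OF order_trans[OF _ coherent_info[OF f F]]]\<close>)

text \<open>This is compactness of finite maps. A member witnessing the first fact and a member
  witnessing the remaining ones have a common upper bound in the directed set, and facts persist
  upwards.\<close>

lemma holds_sup:
  assumes dir: "r \<le> is_directed cantor_domain \<S>" and sup: "r \<le> is_sup cantor_domain \<S> f"
    and F: "r \<le> holds F f"
  shows "r \<le> (\<^bold>\<exists>g. \<S> g \<^bold>\<and> holds F g)"
  using F
proof (induction F)
  case Nil
  \<comment> \<open>The empty list holds of everything, so this case rests on directed sets being
    inhabited.\<close>
  have "holds [] g = top" for g :: "(nat \<Rightarrow> 'a) \<Rightarrow> (bool \<Rightarrow> 'a) \<Rightarrow> 'a" by (simp add: holds_def)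
  then show ?case using directed_inhabited[OF dir] by (simp add: hand_def)
next
  case (Cons p F)
  obtain i b where p: "p = (i, b)" by force
  have "r \<le> component f i b" "r \<le> holds F f" using Cons.prems by (auto simp: le_holds p)
  then have 1: "r \<le> (\<^bold>\<exists>g. \<S> g \<^bold>\<and> component g i b)" and 2: "r \<le> (\<^bold>\<exists>g. \<S> g \<^bold>\<and> holds F g)"
    using cantor_component_sup[OF dir sup] Cons.IH by auto
  from 1 show ?case
  proof (rule le_hexE)
    fix g s assume s: "s \<le> r" "s \<le> (\<S> g \<^bold>\<and> component g i b)"
    have "s \<le> (\<^bold>\<exists>g. \<S> g \<^bold>\<and> holds F g)" using s 2 by order
    then show "s \<le> (\<^bold>\<exists>g. \<S> g \<^bold>\<and> holds (p # F) g)"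
    proof (rule le_hexE)
      fix h t assume t: "t \<le> s" "t \<le> (\<S> h \<^bold>\<and> holds F h)"
      have d: "t \<le> is_directed cantor_domain \<S>" using dir s t by order
      have gh: "t \<le> \<S> g" "t \<le> component g i b" "t \<le> \<S> h" "t \<le> holds F h" using s t by (auto simp: le_hand)
      show "t \<le> (\<^bold>\<exists>g. \<S> g \<^bold>\<and> holds (p # F) g)"
      proof (rule le_hexE[OF directed_bound[OF d, OF gh(1) gh(3)]])
        fix k u assume u: "u \<le> t" "u \<le> (\<S> k \<^bold>\<and> leq cantor_domain g k \<^bold>\<and> leq cantor_domain h k)"
        then have k: "u \<le> \<S> k" "u \<le> leq cantor_domain g k" "u \<le> leq cantor_domain h k"
          by (auto simp: le_hand)
        have ud: "u \<le> is_directed cantor_domain \<S>" using d u by order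
        have ugh: "u \<le> \<S> g" "u \<le> component g i b" "u \<le> \<S> h" "u \<le> holds F h" using gh u(1) by order+
        have el: "u \<le> elem cantor_domain g" "u \<le> elem cantor_domain h" "u \<le> elem cantor_domain k"
          using ugh k by (auto intro: directed_elem[of u cantor_domain \<S>, OF ud])
        have "u \<le> component k i b" by (rule le_liftingD[OF cantor_leqD[OF k(2) el(1,3)], OF ugh(2)])
        moreover have "u \<le> component k j c" if "(j, c) \<in> set F" for j c
          by (rule le_liftingD[OF cantor_leqD[OF k(3) el(2,3)]]) (use that ugh(4) in \<open>auto simp: le_holds\<close>)
        ultimately have "u \<le> holds (p # F) k" by (auto simp: le_holds p)
        then show "u \<le> (\<^bold>\<exists>g. \<S> g \<^bold>\<and> holds (p # F) g)"
          using k(1) by (intro le_hexI[where x=k]) (simp add: le_hand)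
      qed
    qed
  qed
qed

section \<open>The way-below relation and finite approximation\<close>

lemma way_belowI:
  assumes "\<And>s \<S> z. s \<le> r \<Longrightarrow> s \<le> is_directed D \<S> \<Longrightarrow> s \<le> is_sup D \<S> z \<Longrightarrow> s \<le> leq D y z
    \<Longrightarrow> s \<le> (\<^bold>\<exists>t. \<S> t \<^bold>\<and> leq D x t)"
  shows "r \<le> way_below D x y"
  unfolding way_below_def le_hand le_hall le_himp
proof (intro allI impI; (elim conjE)?)
  fix \<S> z s assume "s \<le> r" "s \<le> is_directed D \<S>" "s \<le> is_sup D \<S> z" "s \<le> leq D y z"
  then show "s \<le> (\<^bold>\<exists>t. \<S> t \<^bold>\<and> leq D x t)" by (rule assms[of s \<S> z])
qed

lemma way_belowD:
  assumes "r \<le> way_below D x y"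
    and "r \<le> is_directed D \<S>" and "r \<le> is_sup D \<S> z" and "r \<le> leq D y z"
  shows "r \<le> (\<^bold>\<exists>t. \<S> t \<^bold>\<and> leq D x t)"
proof -
  have "r \<le> (is_directed D \<S> \<^bold>\<and> is_sup D \<S> z \<^bold>\<and> leq D y z \<^bold>\<longrightarrow> (\<^bold>\<exists>t. \<S> t \<^bold>\<and> leq D x t))"
    using assms(1) unfolding way_below_def le_hall by blast
  then show ?thesis by (rule le_mp) (simp add: le_hand assms(2-))
qed

lemma cantor_leq_refl: "r \<le> elem cantor_domain f \<Longrightarrow> r \<le> leq cantor_domain f f"
  by (rule cantor_leqI) (auto simp: le_leq_lifting)

lemma cantor_leq_trans:
  assumes "r \<le> leq cantor_domain f g" and "r \<le> leq cantor_domain g h"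
    and "r \<le> elem cantor_domain f" and "r \<le> elem cantor_domain g" and "r \<le> elem cantor_domain h"
  shows "r \<le> leq cantor_domain f h"
proof (rule cantor_leqI[OF assms(3,5)])
  fix i show "r \<le> leq L2 (component f i) (component h i)"
    using cantor_leqD[OF assms(1,3,4), of i] cantor_leqD[OF assms(2,4,5), of i]
    by (simp add: le_leq_lifting)
qed

text \<open>The maps generated by the lists that hold of \<open>v\<close> form a directed set with
  supremum \<open>v\<close>. Testing the way-below relation on this set yields the list.\<close>

lemma way_below_finite:
  assumes u: "r \<le> elem cantor_domain u" and v: "r \<le> elem cantor_domain v"
    and uv: "r \<le> way_below cantor_domain u v"
  shows "r \<le> (\<^bold>\<exists>F. holds F v \<^bold>\<and> leq cantor_domain u (cantor_map (info F)))"
proof -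
  \<comment> \<open>Membership is Heyting-valued: a list contributes its map at the stages below
    \<open>r\<close> that force \<open>holds F v\<close>. Closing under \<open>eql\<close> makes
    this a subset.\<close>
  define \<B> where "\<B> = (\<lambda>f. elem cantor_domain f \<^bold>\<and> (\<^bold>\<exists>F. holds F v \<^bold>\<and> eql cantor_domain f (cantor_map (info F))))"
  have \<B>I: "s \<le> \<B> (cantor_map (info F))" if "s \<le> r" "s \<le> holds F v" for s F
  proof -
    have "s \<le> elem cantor_domain v" using v that by order
    then have "s \<le> elem cantor_domain (cantor_map (info F))" by (rule elem_cantor_map[OF coherent_info[OF _ that(2)]])
    moreover have "s \<le> (\<^bold>\<exists>F'. holds F' v \<^bold>\<and> eql cantor_domain (cantor_map (info F)) (cantor_map (info F')))"
      by (rule le_hexI[where x=F]) (simp add: le_hand that le_eql_cantor)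
    ultimately show ?thesis by (simp add: \<B>_def le_hand)
  qed
  have \<B>E: "s \<le> q"
    if "s \<le> r" "s \<le> \<B> f"
      and step: "\<And>t F. t \<le> s \<Longrightarrow> t \<le> holds F v \<Longrightarrow> t \<le> elem cantor_domain f \<Longrightarrow> t \<le> elem cantor_domain (cantor_map (info F))
        \<Longrightarrow> t \<le> leq cantor_domain f (cantor_map (info F)) \<Longrightarrow> t \<le> leq cantor_domain (cantor_map (info F)) f
        \<Longrightarrow> t \<le> eql cantor_domain f (cantor_map (info F)) \<Longrightarrow> t \<le> q"
    for s f q
  proof -
    have "s \<le> (\<^bold>\<exists>F. holds F v \<^bold>\<and> eql cantor_domain f (cantor_map (info F)))" using that(2) by (simp add: \<B>_def le_hand)
    then show ?thesis
    proof (rule le_hexE)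
      fix F t assume t: "t \<le> s" "t \<le> (holds F v \<^bold>\<and> eql cantor_domain f (cantor_map (info F)))"
      then have F: "t \<le> holds F v" "t \<le> eql cantor_domain f (cantor_map (info F))" by (auto simp: le_hand)
      have tv: "t \<le> elem cantor_domain v" using v that(1) t(1) by order
      have "t \<le> \<B> f" using that(2) t(1) by order
      then have el: "t \<le> elem cantor_domain f" "t \<le> elem cantor_domain (cantor_map (info F))"
        using elem_cantor_map[OF coherent_info[OF tv F(1)]] by (auto simp: \<B>_def le_hand)
      have "t \<le> eql L2 (component f i) (component (cantor_map (info F)) i)" for i by (rule component_cong[OF F(2)])
      then have "t \<le> leq cantor_domain f (cantor_map (info F))" "t \<le> leq cantor_domain (cantor_map (info F)) f"
        by (auto intro!: cantor_leqI el simp: le_leq_lifting le_eql_lifting)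
      then show "t \<le> q" using step t(1) F el by blast
    qed
  qed
  have dir: "r \<le> is_directed cantor_domain \<B>"
  proof (rule is_directedI)
    show "r \<le> is_subset cantor_domain \<B>"
    proof (rule is_subsetI)
      fix s f g assume s: "s \<le> r" "s \<le> \<B> f" "s \<le> elem cantor_domain g" "s \<le> eql cantor_domain f g"
      have "s \<le> (\<^bold>\<exists>F. holds F v \<^bold>\<and> eql cantor_domain g (cantor_map (info F)))"
      proof (rule \<B>E[OF s(1,2)])
        fix t F assume t: "t \<le> s" "t \<le> holds F v" "t \<le> eql cantor_domain f (cantor_map (info F))"
        then have "t \<le> eql cantor_domain g (cantor_map (info F))" using s(4) by (auto simp: le_eql_cantor)
        then show "t \<le> (\<^bold>\<exists>F. holds F v \<^bold>\<and> eql cantor_domain g (cantor_map (info F)))"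
          using t by (intro le_hexI[where x=F]) (simp add: le_hand)
      qed
      then show "s \<le> \<B> g" using s by (simp add: \<B>_def le_hand)
    qed (simp add: \<B>_def le_hand)
    show "r \<le> (\<^bold>\<exists>f. \<B> f)"
      by (rule le_hexI[where x="cantor_map (info [])"], rule \<B>I) (auto simp: le_holds)
    fix s f g assume s: "s \<le> r" "s \<le> \<B> f" "s \<le> \<B> g"
    show "s \<le> (\<^bold>\<exists>h. \<B> h \<^bold>\<and> leq cantor_domain f h \<^bold>\<and> leq cantor_domain g h)"
    proof (rule \<B>E[OF s(1,2)])
      fix t F assume t: "t \<le> s" "t \<le> holds F v" "t \<le> elem cantor_domain f"
        "t \<le> elem cantor_domain (cantor_map (info F))" "t \<le> leq cantor_domain f (cantor_map (info F))"
      have t': "t \<le> r" "t \<le> \<B> g" using s t by order+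
      show "t \<le> (\<^bold>\<exists>h. \<B> h \<^bold>\<and> leq cantor_domain f h \<^bold>\<and> leq cantor_domain g h)"
      proof (rule \<B>E[OF t'])
        fix w G assume w: "w \<le> t" "w \<le> holds G v" "w \<le> elem cantor_domain g"
          "w \<le> elem cantor_domain (cantor_map (info G))" "w \<le> leq cantor_domain g (cantor_map (info G))"
        have wF: "w \<le> holds F v" "w \<le> elem cantor_domain f"
          "w \<le> elem cantor_domain (cantor_map (info F))" "w \<le> leq cantor_domain f (cantor_map (info F))" "w \<le> r"
          using t t' w by order+
        have wv: "w \<le> elem cantor_domain v" using v wF by order
        \<comment> \<open>The appended list holds of \<open>v\<close> because both lists do, and it
          generates an upper bound of the two maps.\<close>
        have FG: "w \<le> holds (F @ G) v" using wF w by (auto simp: le_holds)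
        have el: "w \<le> elem cantor_domain (cantor_map (info (F @ G)))" by (rule elem_cantor_map[OF coherent_info[OF wv FG]])
        have "w \<le> leq cantor_domain (cantor_map (info H)) (cantor_map (info (F @ G)))" if "H = F \<or> H = G" for H
        proof (rule cantor_leqI[OF _ el])
          have H: "w \<le> coherent (info H)" using coherent_info[OF wv] wF w that by auto
          show "w \<le> elem cantor_domain (cantor_map (info H))" by (rule elem_cantor_map[OF H])
          fix i show "w \<le> leq L2 (component (cantor_map (info H)) i) (component (cantor_map (info (F @ G))) i)"
            unfolding le_leq_lifting
          proof (intro allI impI)
            fix x b assume x: "x \<le> w" "x \<le> component (cantor_map (info H)) i b"
            have "x \<le> coherent (info H)" "x \<le> coherent (info (F @ G))"
              using x H coherent_info[OF wv FG] by order+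
            then show "x \<le> component (cantor_map (info (F @ G))) i b"
              using x(2) that by (auto simp: component_cantor_map info_def bot_unique split: if_splits)
          qed
        qed
        then have "w \<le> leq cantor_domain f (cantor_map (info (F @ G)))" "w \<le> leq cantor_domain g (cantor_map (info (F @ G)))"
          using wF w el by (auto intro: cantor_leq_trans)
        then show "w \<le> (\<^bold>\<exists>h. \<B> h \<^bold>\<and> leq cantor_domain f h \<^bold>\<and> leq cantor_domain g h)"
          using \<B>I[OF wF(5) FG] by (intro le_hexI[where x="cantor_map (info (F @ G))"]) (simp add: le_hand)
      qed
    qed
  qed
  have sup: "r \<le> is_sup cantor_domain \<B> v"
  proof (rule is_supI[OF v])
    fix s f assume s: "s \<le> r" "s \<le> \<B> f"
    show "s \<le> leq cantor_domain f v"
    proof (rule \<B>E[OF s])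
      fix t F assume t: "t \<le> s" "t \<le> holds F v" "t \<le> elem cantor_domain f"
        "t \<le> elem cantor_domain (cantor_map (info F))" "t \<le> leq cantor_domain f (cantor_map (info F))"
      have tv: "t \<le> elem cantor_domain v" using v s t by order
      show "t \<le> leq cantor_domain f v"
        by (rule cantor_leq_trans[OF t(5) finite_below[OF tv t(2)] t(3,4) tv])
    qed
  next
    fix s g assume s: "s \<le> r" "s \<le> elem cantor_domain g"
      and ub: "\<And>t f. t \<le> s \<Longrightarrow> t \<le> \<B> f \<Longrightarrow> t \<le> leq cantor_domain f g"
    have sv: "s \<le> elem cantor_domain v" using v s by order
    show "s \<le> leq cantor_domain v g"
    proof (rule cantor_leqI[OF sv s(2)])
      fix i show "s \<le> leq L2 (component v i) (component g i)"
        unfolding le_leq_lifting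
      proof (intro allI impI)
        fix t b assume t: "t \<le> s" "t \<le> component v i b"
        have el: "t \<le> elem cantor_domain v" "t \<le> elem cantor_domain g" "t \<le> r" using sv s t by order+
        \<comment> \<open>For leastness, one-element lists suffice: each fact of \<open>v\<close>
          occurs in the map that it generates, and this map lies below \<open>g\<close>.\<close>
        have F: "t \<le> holds [(i, b)] v" using t by (simp add: le_holds)
        have "t \<le> leq cantor_domain (cantor_map (info [(i, b)])) g" using ub[OF t(1) \<B>I[OF el(3) F]] .
        then have "t \<le> leq L2 (component (cantor_map (info [(i, b)])) i) (component g i)"
          by (rule cantor_leqD[OF _ elem_cantor_map[OF coherent_info[OF el(1) F]] el(2)])
        then show "t \<le> component g i b"
          by (rule le_liftingD) (simp add: component_cantor_map[OF coherent_info[OF el(1) F]] info_def)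
      qed
    qed
  qed
  have "r \<le> (\<^bold>\<exists>f. \<B> f \<^bold>\<and> leq cantor_domain u f)"
    by (rule way_belowD[OF uv dir sup cantor_leq_refl[OF v]])
  then show ?thesis
  proof (rule le_hexE)
    fix f s assume s: "s \<le> r" "s \<le> (\<B> f \<^bold>\<and> leq cantor_domain u f)"
    then have f: "s \<le> \<B> f" "s \<le> leq cantor_domain u f" by (auto simp: le_hand)
    show "s \<le> (\<^bold>\<exists>F. holds F v \<^bold>\<and> leq cantor_domain u (cantor_map (info F)))"
    proof (rule \<B>E[OF s(1) f(1)])
      fix t F assume t: "t \<le> s" "t \<le> holds F v" "t \<le> elem cantor_domain f"
        "t \<le> elem cantor_domain (cantor_map (info F))" "t \<le> leq cantor_domain f (cantor_map (info F))"
      have "t \<le> leq cantor_domain u f" "t \<le> elem cantor_domain u" using u f s t by order+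
      then have "t \<le> leq cantor_domain u (cantor_map (info F))" using t by (auto intro: cantor_leq_trans)
      then show "t \<le> (\<^bold>\<exists>F. holds F v \<^bold>\<and> leq cantor_domain u (cantor_map (info F)))"
        using t(2) by (intro le_hexI[where x=F]) (simp add: le_hand)
    qed
  qed
qed

text \<open>If a directed supremum lies above \<open>x\<close>, the list holds of the supremum,
  hence of some member by \<open>holds_sup\<close>. That member lies above the finite map and so
  above \<open>u\<close>.\<close>

lemma holds_way_below:
  assumes u: "r \<le> elem cantor_domain u" and x: "r \<le> elem cantor_domain x"
    and F: "r \<le> holds F x" and le: "r \<le> leq cantor_domain u (cantor_map (info F))"
  shows "r \<le> way_below cantor_domain u x"
proof (rule way_belowI)
  fix s \<S> f
  assume s: "s \<le> r" and dir: "s \<le> is_directed cantor_domain \<S>" and sup: "s \<le> is_sup cantor_domain \<S> f"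
    and xf: "s \<le> leq cantor_domain x f"
  have sx: "s \<le> elem cantor_domain x" "s \<le> holds F x" using x F s by order+
  have "s \<le> component f i b" if "(i, b) \<in> set F" for i b
    by (rule le_liftingD[OF cantor_leqD[OF xf sx(1) sup_elem[OF sup]]])
      (use that sx(2) in \<open>auto simp: le_holds\<close>)
  then have "s \<le> holds F f" by (auto simp: le_holds)
  then have "s \<le> (\<^bold>\<exists>g. \<S> g \<^bold>\<and> holds F g)" by (rule holds_sup[OF dir sup])
  then show "s \<le> (\<^bold>\<exists>g. \<S> g \<^bold>\<and> leq cantor_domain u g)"
  proof (rule le_hexE)
    fix g t assume t: "t \<le> s" "t \<le> (\<S> g \<^bold>\<and> holds F g)"
    then have g: "t \<le> \<S> g" "t \<le> holds F g" by (auto simp: le_hand)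
    have td: "t \<le> is_directed cantor_domain \<S>" and tu: "t \<le> elem cantor_domain u"
      and tle: "t \<le> leq cantor_domain u (cantor_map (info F))"
      using dir u le s t by order+
    have tg: "t \<le> elem cantor_domain g" by (rule directed_elem[OF td, OF g(1)])
    have "t \<le> leq cantor_domain u g"
      by (rule cantor_leq_trans[OF tle finite_below[OF tg g(2)] tu elem_cantor_map[OF coherent_info[OF tg g(2)]] tg])
    then show "t \<le> (\<^bold>\<exists>g. \<S> g \<^bold>\<and> leq cantor_domain u g)"
      using g(1) by (intro le_hexI[where x=g]) (simp add: le_hand)
  qed
qed

section \<open>Sharpness of elements with decidable components\<close>

lemma holds_decidable:
  assumes "\<And>i b. r \<le> (component x i b \<^bold>\<or> \<^bold>\<not> component x i b)"
  shows "r \<le> (holds F x \<^bold>\<or> \<^bold>\<not> holds F x)"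
proof (induction F)
  case Nil
  then show ?case by (rule le_horI1) (simp add: holds_def)
next
  case (Cons p F)
  obtain i b where p: "p = (i, b)" by force
  \<comment> \<open>Finiteness matters here: a conjunction of decidable propositions along a list is
    decidable, which can fail constructively for infinitely many.\<close>
  from Cons.IH show ?case
  proof (rule le_horE)
    fix s assume s: "s \<le> r" "s \<le> holds F x"
    have "s \<le> (component x i b \<^bold>\<or> \<^bold>\<not> component x i b)" using s(1) assms[of i b] by order
    then show "s \<le> (holds (p # F) x \<^bold>\<or> \<^bold>\<not> holds (p # F) x)"
    proof (rule le_horE)
      fix t assume "t \<le> s" "t \<le> component x i b"
      then show "t \<le> (holds (p # F) x \<^bold>\<or> \<^bold>\<not> holds (p # F) x)"
        using s by (intro le_horI1) (auto simp: le_holds p)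
    next
      fix t assume "t \<le> s" "t \<le> (\<^bold>\<not> component x i b)"
      then show "t \<le> (holds (p # F) x \<^bold>\<or> \<^bold>\<not> holds (p # F) x)"
        by (intro le_horI2) (auto simp: le_holds le_hnot p)
    qed
  next
    fix s assume "s \<le> r" "s \<le> (\<^bold>\<not> holds F x)"
    then show "s \<le> (holds (p # F) x \<^bold>\<or> \<^bold>\<not> holds (p # F) x)"
      by (intro le_horI2) (auto simp: le_holds le_hnot)
  qed
qed

lemma is_sharpI:
  assumes "\<And>s u v. s \<le> r \<Longrightarrow> s \<le> elem D u \<Longrightarrow> s \<le> elem D v \<Longrightarrow> s \<le> way_below D u v
    \<Longrightarrow> s \<le> (way_below D u x \<^bold>\<or> \<^bold>\<not> leq D v x)"
  shows "r \<le> is_sharp D x"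
  unfolding is_sharp_def le_hand le_hall le_himp
proof (intro allI impI; (elim conjE)?)
  fix s u v assume "s \<le> r" "s \<le> elem D u" "s \<le> elem D v" "s \<le> way_below D u v"
  then show "s \<le> (way_below D u x \<^bold>\<or> \<^bold>\<not> leq D v x)" by (rule assms[of s u v])
qed

text \<open>Let \<open>F\<close> hold of \<open>v\<close>, with \<open>u\<close> below its map. If
  \<open>F\<close> holds of \<open>x\<close>, then \<open>u\<close> is way below \<open>x\<close>.
  If not, \<open>v\<close> cannot be below \<open>x\<close>, because the facts in \<open>F\<close>
  would pass from \<open>v\<close> to \<open>x\<close>.\<close>

lemma decidable_sharp:
  assumes x: "r \<le> elem cantor_domain x" and dec: "\<And>i b. r \<le> (component x i b \<^bold>\<or> \<^bold>\<not> component x i b)"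
  shows "r \<le> is_sharp cantor_domain x"
proof (rule is_sharpI)
  fix s u v
  let ?goal = "way_below cantor_domain u x \<^bold>\<or> \<^bold>\<not> leq cantor_domain v x"
  assume s: "s \<le> r" and u: "s \<le> elem cantor_domain u" and v: "s \<le> elem cantor_domain v"
    and uv: "s \<le> way_below cantor_domain u v"
  from way_below_finite[OF u v uv] show "s \<le> ?goal"
  proof (rule le_hexE)
    fix F t assume t: "t \<le> s" "t \<le> (holds F v \<^bold>\<and> leq cantor_domain u (cantor_map (info F)))"
    then have F: "t \<le> holds F v" "t \<le> leq cantor_domain u (cantor_map (info F))" by (auto simp: le_hand)
    have "t \<le> (holds F x \<^bold>\<or> \<^bold>\<not> holds F x)"
      by (rule order_trans[OF _ holds_decidable[OF dec]]) (use s t in order)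
    then show "t \<le> ?goal"
    proof (rule le_horE)
      fix w assume w: "w \<le> t" "w \<le> holds F x"
      have "w \<le> elem cantor_domain u" "w \<le> elem cantor_domain x" "w \<le> leq cantor_domain u (cantor_map (info F))"
        using u x F s t w by order+
      then show "w \<le> ?goal" using w(2) by (intro le_horI1 holds_way_below[of w u x F])
    next
      fix w assume w: "w \<le> t" "w \<le> (\<^bold>\<not> holds F x)"
      have "w' = bot" if w': "w' \<le> w" "w' \<le> leq cantor_domain v x" for w'
      proof -
        have el: "w' \<le> elem cantor_domain v" "w' \<le> elem cantor_domain x" "w' \<le> holds F v"
          using v x F s t w w' by order+
        have "w' \<le> component x i b" if "(i, b) \<in> set F" for i b
          by (rule le_liftingD[OF cantor_leqD[OF w'(2) el(1,2)]]) (use that el(3) in \<open>auto simp: le_holds\<close>)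
        then have "w' \<le> holds F x" by (auto simp: le_holds)
        then show "w' = bot" using w w' by (simp add: le_hnot)
      qed
      then have "w \<le> (\<^bold>\<not> leq cantor_domain v x)" by (simp add: le_hnot)
      then show "w \<le> ?goal" by (rule le_horI2)
    qed
  qed
qed

text \<open>Membership in the image is only up to \<open>eql\<close>, so sharpness must be
  transferred along it. Sharpness concerns \<open>f\<close> only through \<open>leq\<close>, which
  sees nothing but the graph.\<close>

lemma sharp_cong:
  assumes fg: "r \<le> eql cantor_domain f g" and g: "r \<le> is_sharp cantor_domain g"
  shows "r \<le> is_sharp cantor_domain f"
proof (rule is_sharpI)
  fix s u v
  assume s: "s \<le> r" and u: "s \<le> elem cantor_domain u" and v: "s \<le> elem cantor_domain v"
    and uv: "s \<le> way_below cantor_domain u v"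
  have eq: "t \<le> f S T \<longleftrightarrow> t \<le> g S T" if "t \<le> r" for t S T
    using fg that by (simp add: le_eql_cantor)
  have "s \<le> is_sharp cantor_domain g" using s g by order
  then have "s \<le> (elem cantor_domain u \<^bold>\<and> elem cantor_domain v \<^bold>\<and> way_below cantor_domain u v
      \<^bold>\<longrightarrow> way_below cantor_domain u g \<^bold>\<or> \<^bold>\<not> leq cantor_domain v g)"
    unfolding is_sharp_def le_hall by blast
  then have "s \<le> (way_below cantor_domain u g \<^bold>\<or> \<^bold>\<not> leq cantor_domain v g)"
    by (rule le_mp) (simp add: le_hand u v uv)
  then show "s \<le> (way_below cantor_domain u f \<^bold>\<or> \<^bold>\<not> leq cantor_domain v f)"
  proof (rule le_horE)
    fix t assume t: "t \<le> s" "t \<le> way_below cantor_domain u g"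
    have "t \<le> way_below cantor_domain u f"
    proof (rule way_belowI)
      fix w \<S> z assume w: "w \<le> t" "w \<le> is_directed cantor_domain \<S>" "w \<le> is_sup cantor_domain \<S> z"
        "w \<le> leq cantor_domain f z"
      have "w \<le> leq cantor_domain g z"
        unfolding le_leq_cantor
      proof (intro allI impI)
        fix w' S T T' assume w': "w' \<le> w" "w' \<le> g S T" "w' \<le> z S T'"
        have "w' \<le> r" using s t w w' by order
        then show "w' \<le> leq L2 T T'" using w(4) w' eq unfolding le_leq_cantor by blast
      qed
      moreover have "w \<le> way_below cantor_domain u g" using t w by order
      ultimately show "w \<le> (\<^bold>\<exists>t. \<S> t \<^bold>\<and> leq cantor_domain u t)"
        using way_belowD[of w cantor_domain u g \<S> z] w by blast
    qed
    then show "t \<le> (way_below cantor_domain u f \<^bold>\<or> \<^bold>\<not> leq cantor_domain v f)" by (rule le_horI1)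
  next
    fix t assume t: "t \<le> s" "t \<le> (\<^bold>\<not> leq cantor_domain v g)"
    have "w = bot" if w: "w \<le> t" "w \<le> leq cantor_domain v f" for w
    proof -
      have "w \<le> leq cantor_domain v g"
        unfolding le_leq_cantor
      proof (intro allI impI)
        fix w' S T T' assume w': "w' \<le> w" "w' \<le> v S T" "w' \<le> g S T'"
        have "w' \<le> r" using s t w w' by order
        then show "w' \<le> leq L2 T T'" using w(2) w' eq unfolding le_leq_cantor by blast
      qed
      then show "w = bot" using t(2) w(1) by (simp add: le_hnot)
    qed
    then have "t \<le> (\<^bold>\<not> leq cantor_domain v f)" by (simp add: le_hnot)
    then show "t \<le> (way_below cantor_domain u f \<^bold>\<or> \<^bold>\<not> leq cantor_domain v f)" by (rule le_horI2)
  qed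
qed

section \<open>The image of Cantor space\<close>

text \<open>The map induced on liftings sends the empty set to itself, hence the empty component at
  \<open>None\<close>.\<close>

definition strict_family :: "(nat \<Rightarrow> bool \<Rightarrow> 'h) \<Rightarrow> nat option \<Rightarrow> bool \<Rightarrow> 'h::complete_heyting_algebra"
  where "strict_family \<alpha> i = (case i of None \<Rightarrow> \<lambda>_. bot | Some n \<Rightarrow> \<alpha> n)"

lemma assemble_strict: "assemble (strict_family \<alpha>) S = direct_image \<alpha> S"
proof
  fix b
  \<comment> \<open>The indices are \<open>None\<close>, whose term is \<open>bot\<close>, and the
    numbers, whose terms form the direct image.\<close>
  show "assemble (strict_family \<alpha>) S b = direct_image \<alpha> S b"
    unfolding assemble_def direct_image_def hex_def hand_def UNIV_option_conv
    by (simp add: strict_family_def point_in_def image_image)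
qed

lemma epsilon_eq_cantor_map: "epsilon \<alpha> = cantor_map (strict_family \<alpha>)"
  by (intro ext) (simp add: epsilon_def lifting_map_def cantor_map_def assemble_strict)

lemma coherent_strict:
  assumes "r \<le> is_function hnat htwo \<alpha>"
  shows "r \<le> coherent (strict_family \<alpha>)"
  unfolding le_coherent
proof (intro allI conjI)
  fix i
  have "a = b \<or> s = bot" if "s \<le> r" "s \<le> \<alpha> n a" "s \<le> \<alpha> n b" for s n a b
  proof -
    have "s \<le> is_function hnat htwo \<alpha>" using assms that by order
    from function_unique[OF this, OF that(2,3)] show ?thesis
      by (auto simp: discrete_def bot_unique split: if_splits)
  qed
  then show "r \<le> elem L2 (strict_family \<alpha> i)"
    by (auto simp: le_elem_lifting strict_family_def bot_unique split: option.splits)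
  show "r \<le> leq L2 (strict_family \<alpha> None) (strict_family \<alpha> i)"
    by (auto simp: le_leq_lifting strict_family_def bot_unique)
qed

text \<open>Totality gives some value \<open>c\<close> locally, and \<open>b\<close> and
  \<open>c\<close> are compared in the meta-logic. If they differ, uniqueness of values refutes
  \<open>b\<close>.\<close>

lemma function_two_decidable:
  assumes \<alpha>: "r \<le> is_function hnat htwo \<alpha>"
  shows "r \<le> (\<alpha> n b \<^bold>\<or> \<^bold>\<not> \<alpha> n b)"
proof -
  have "r \<le> (\<^bold>\<exists>c. \<alpha> n c)" by (rule function_total[OF \<alpha>]) (simp add: discrete_def)
  then show ?thesis
  proof (rule le_hexE)
    fix c s assume s: "s \<le> r" "s \<le> \<alpha> n c"
    show "s \<le> (\<alpha> n b \<^bold>\<or> \<^bold>\<not> \<alpha> n b)"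
    proof (cases "b = c")
      case True
      then show ?thesis using s by (intro le_horI1) simp
    next
      case False
      have "t = bot" if t: "t \<le> s" "t \<le> \<alpha> n b" for t
      proof -
        have "t \<le> is_function hnat htwo \<alpha>" "t \<le> \<alpha> n c" using \<alpha> s t by order+
        from function_unique[OF this(1), OF this(2) t(2)] show ?thesis
          using False by (simp add: discrete_def bot_unique)
      qed
      then show ?thesis by (intro le_horI2) (simp add: le_hnot)
    qed
  qed
qed

lemma component_decidable:
  assumes C: "r \<le> coherent C" and dec: "r \<le> (C i b \<^bold>\<or> \<^bold>\<not> C i b)"
  shows "r \<le> (component (cantor_map C) i b \<^bold>\<or> \<^bold>\<not> component (cantor_map C) i b)"
proof -
  have eq: "t \<le> component (cantor_map C) i b \<longleftrightarrow> t \<le> C i b" if "t \<le> r" for t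
    by (rule component_cantor_map[OF order_trans[OF that C]])
  from dec show ?thesis
  proof (rule le_horE)
    fix s assume "s \<le> r" "s \<le> C i b"
    then show "s \<le> (component (cantor_map C) i b \<^bold>\<or> \<^bold>\<not> component (cantor_map C) i b)" by (intro le_horI1) (simp add: eq)
  next
    fix s assume "s \<le> r" "s \<le> (\<^bold>\<not> C i b)"
    then show "s \<le> (component (cantor_map C) i b \<^bold>\<or> \<^bold>\<not> component (cantor_map C) i b)" by (intro le_horI2) (auto simp: le_hnot eq)
  qed
qed

lemma image_epsilon_sharp:
  assumes "r \<le> in_image_epsilon f"
  shows "r \<le> is_sharp cantor_domain f"
  using assms unfolding in_image_epsilon_def
proof (rule le_hexE)
  fix \<alpha> s assume "s \<le> r" "s \<le> (is_function hnat htwo \<alpha> \<^bold>\<and> eql cantor_domain f (epsilon \<alpha>))"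
  then have \<alpha>: "s \<le> is_function hnat htwo \<alpha>" and eq: "s \<le> eql cantor_domain f (epsilon \<alpha>)"
    by (auto simp: le_hand)
  have C: "s \<le> coherent (strict_family \<alpha>)" by (rule coherent_strict[OF \<alpha>])
  \<comment> \<open>The component at \<open>None\<close> is empty and so refuted; the others are the
    decidable values of \<alpha>.\<close>
  have "s \<le> (strict_family \<alpha> i b \<^bold>\<or> \<^bold>\<not> strict_family \<alpha> i b)" for i b
  proof (cases i)
    case None
    then show ?thesis by (intro le_horI2) (simp add: strict_family_def le_hnot bot_unique)
  next
    case (Some n)
    then show ?thesis using function_two_decidable[OF \<alpha>] by (simp add: strict_family_def)
  qed
  then have "s \<le> is_sharp cantor_domain (cantor_map (strict_family \<alpha>))"
    by (intro decidable_sharp elem_cantor_map component_decidable C)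
  then show "s \<le> is_sharp cantor_domain f"
    by (rule sharp_cong[OF eq[unfolded epsilon_eq_cantor_map]])
qed

section \<open>The two counterexamples\<close>

lemma not_all_image_epsilon_maximal:
  assumes "r \<le> (\<^bold>\<forall>f. in_image_epsilon f \<^bold>\<longrightarrow> is_maximal cantor_domain f)"
  shows "r = bot"
proof -
  \<comment> \<open>This is the singleton {0}, as \<open>False\<close> stands for 0. It serves both
    as a row of the graph of the zero sequence and as an element of the lifting.\<close>
  define zero where "zero = (\<lambda>b. if b then bot else top :: 'a)"
  define \<alpha> where "\<alpha> = (\<lambda>n :: nat. zero)"
  \<comment> \<open>The constant map with value {0} agrees with the image of the zero sequence at
    singletons and is larger at the empty set.\<close>
  define c where "c = (\<lambda>i :: nat option. zero)"
  have \<alpha>: "r \<le> is_function hnat htwo \<alpha>"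
    by (rule is_functionI)
      (auto simp: \<alpha>_def zero_def discrete_def bot_unique split: if_splits intro!: le_hexI[where x=False])
  have C: "r \<le> coherent (strict_family \<alpha>)" by (rule coherent_strict[OF \<alpha>])
  have c: "r \<le> coherent c"
    by (auto simp: le_coherent c_def zero_def le_elem_lifting le_leq_lifting bot_unique)
  have "r \<le> in_image_epsilon (epsilon \<alpha>)"
    unfolding in_image_epsilon_def by (rule le_hexI[where x=\<alpha>]) (simp add: le_hand \<alpha> le_eql_cantor)
  then have "r \<le> is_maximal cantor_domain (cantor_map (strict_family \<alpha>))"
    using assms by (simp add: le_hall le_himp epsilon_eq_cantor_map)
  then have "r \<le> (elem cantor_domain (cantor_map c) \<^bold>\<and> leq cantor_domain (cantor_map (strict_family \<alpha>)) (cantor_map c)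
      \<^bold>\<longrightarrow> leq cantor_domain (cantor_map c) (cantor_map (strict_family \<alpha>)))"
    unfolding is_maximal_def le_hall by blast
  moreover have "r \<le> leq cantor_domain (cantor_map (strict_family \<alpha>)) (cantor_map c)"
  proof (rule cantor_leqI[OF elem_cantor_map[OF C] elem_cantor_map[OF c]])
    fix i show "r \<le> leq L2 (component (cantor_map (strict_family \<alpha>)) i) (component (cantor_map c) i)"
      unfolding le_leq_lifting
    proof (intro allI impI)
      fix s b assume s: "s \<le> r" "s \<le> component (cantor_map (strict_family \<alpha>)) i b"
      have "s \<le> coherent (strict_family \<alpha>)" "s \<le> coherent c" using s C c by order+
      then show "s \<le> component (cantor_map c) i b"
        using s(2) by (auto simp: component_cantor_map strict_family_def c_def \<alpha>_def bot_unique split: option.splits)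
    qed
  qed
  ultimately have "r \<le> leq cantor_domain (cantor_map c) (cantor_map (strict_family \<alpha>))"
    using elem_cantor_map[OF c] by (simp add: le_himp le_hand)
  then have "r \<le> leq L2 (component (cantor_map c) None) (component (cantor_map (strict_family \<alpha>)) None)"
    by (rule cantor_leqD[OF _ elem_cantor_map[OF c] elem_cantor_map[OF C]])
  \<comment> \<open>At the empty set the constant map still contains 0, while the image of \<alpha>
    is empty there.\<close>
  moreover have "r \<le> component (cantor_map c) None False"
    unfolding component_cantor_map[OF c] by (simp add: c_def zero_def)
  ultimately have "r \<le> component (cantor_map (strict_family \<alpha>)) None False" by (rule le_liftingD)
  then show ?thesis by (simp add: component_cantor_map[OF C] strict_family_def bot_unique)
qed

lemma not_all_sharp_image_epsilon:
  assumes "r \<le> (\<^bold>\<forall>f. elem cantor_domain f \<^bold>\<and> is_sharp cantor_domain f \<^bold>\<longrightarrow> in_image_epsilon f)"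
  shows "r = bot"
proof -
  \<comment> \<open>The family of empty values generates the least map; all its components are
    refuted, hence decidable.\<close>
  define c where "c = (\<lambda>(i :: nat option) (b :: bool). bot :: 'a)"
  have c: "r \<le> coherent c"
    by (auto simp: le_coherent c_def le_elem_lifting le_leq_lifting bot_unique)
  have "r \<le> (c i b \<^bold>\<or> \<^bold>\<not> c i b)" for i b
    by (rule le_horI2) (simp add: c_def le_hnot bot_unique)
  then have "r \<le> is_sharp cantor_domain (cantor_map c)"
    by (intro decidable_sharp elem_cantor_map component_decidable c)
  then have "r \<le> in_image_epsilon (cantor_map c)"
    using assms elem_cantor_map[OF c] by (simp add: le_hall le_himp le_hand)
  then have "r \<le> bot"
    unfolding in_image_epsilon_def
  proof (rule le_hexE)
    fix \<alpha> s assume s: "s \<le> r" "s \<le> (is_function hnat htwo \<alpha> \<^bold>\<and> eql cantor_domain (cantor_map c) (epsilon \<alpha>))"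
    then have \<alpha>: "s \<le> is_function hnat htwo \<alpha>" and eq: "s \<le> eql cantor_domain (cantor_map c) (cantor_map (strict_family \<alpha>))"
      by (auto simp: le_hand epsilon_eq_cantor_map)
    \<comment> \<open>Any number would do in place of 0. A total \<alpha> has a value there, so its
      image is inhabited at that singleton, where the least map is empty.\<close>
    have "s \<le> (\<^bold>\<exists>b. \<alpha> 0 b)" by (rule function_total[OF \<alpha>]) (simp add: discrete_def)
    then show "s \<le> bot"
    proof (rule le_hexE)
      fix b t assume t: "t \<le> s" "t \<le> \<alpha> 0 b"
      have tc: "t \<le> coherent c" "t \<le> coherent (strict_family \<alpha>)"
        using c coherent_strict[OF \<alpha>] s t by order+
      have "t \<le> component (cantor_map (strict_family \<alpha>)) (Some 0) b" using t by (simp add: component_cantor_map[OF tc(2)] strict_family_def)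
      then have "t \<le> component (cantor_map c) (Some 0) b"
        using component_cong[OF eq, of "Some 0"] t(1) by (simp add: le_eql_lifting)
      then have "t \<le> c (Some 0) b" by (simp add: component_cantor_map[OF tc(1)])
      then show "t \<le> bot" by (simp add: c_def)
    qed
  qed
  then show ?thesis by (simp add: bot_unique)
qed

theorem theorem7p25:
  shows "valid
    ((\<^bold>\<forall>f. in_image_epsilon f \<^bold>\<longrightarrow> is_sharp cantor_domain f) \<^bold>\<and>
     \<^bold>\<not> (\<^bold>\<forall>f. in_image_epsilon f \<^bold>\<longrightarrow> is_maximal cantor_domain f) \<^bold>\<and>
     \<^bold>\<not> (\<^bold>\<forall>f. elem cantor_domain f \<^bold>\<and> is_sharp cantor_domain f \<^bold>\<longrightarrow> in_image_epsilon f)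
     :: 'h::complete_heyting_algebra)"
proof -
  have "(top :: 'h) \<le> (\<^bold>\<forall>f. in_image_epsilon f \<^bold>\<longrightarrow> is_sharp cantor_domain f)"
    unfolding le_hall le_himp using image_epsilon_sharp by blast
  \<comment> \<open>A negation is forced when every stage forcing the negated statement is
    \<open>bot\<close>, which is the form of both counterexamples.\<close>
  moreover have "(top :: 'h) \<le> (\<^bold>\<not> (\<^bold>\<forall>f. in_image_epsilon f \<^bold>\<longrightarrow> is_maximal cantor_domain f))"
    unfolding le_hnot using not_all_image_epsilon_maximal by blast
  moreover have "(top :: 'h) \<le>
      (\<^bold>\<not> (\<^bold>\<forall>f. elem cantor_domain f \<^bold>\<and> is_sharp cantor_domain f \<^bold>\<longrightarrow> in_image_epsilon f))"
    unfolding le_hnot using not_all_sharp_image_epsilon by blast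
  ultimately show ?thesis
    unfolding valid_def by (intro top_le) (simp add: le_hand)
qed

end
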